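(* Let $A(h)$ and $T(h)$, $h\in(0,1/6)$, be the area and period functions associated to the Hamiltonian system with $H(x,y)=x^2/2+y^2/2+x^3/3$. (i) The functions $A$ and $T$ verify the $2\times 2$ Picard-Fuchs equations $$6(6h-1)h\begin{pmatrix}A'(h)\\ T'(h)\end{pmatrix}=\begin{pmatrix}0&6(6h-1)h\\ -5&0\end{pmatrix}\begin{pmatrix}A(h)\\ T(h)\end{pmatrix}.$$ (ii) The function $A$ verifies the Hill's equation $$A''(h)=\frac{5}{6(1-6h)h}A(h).$$ (iii) The function $p(h)=T(h)/A(h)$ satisfies the Riccati differential equation $$p'(h)=-p^2(h)+\frac{5}{6(1-6h)h}.$$ (iv) Let $I_j(h)=\int_{\gamma_h}x^jy\,dx$ for $j\ge 0$. Then $I_0(h)=-A(h)$ and, for every integer $n\ge 0$, $$I_{3n+1}(h)=a_{n+1}(h)A(h)+b_n(h)(6h-1)hT(h),$$ $$I_{3n+2}(h)=c_{n+1}(h)A(h)+d_n(h)(6h-1)hT(h),$$ $$I_{3n+3}(h)=e_{n+1}(h)A(h)+f_n(h)(6h-1)hT(h),$$ where, for $g\in\{a,b,c,d,e,f\}$, $g_k$ denotes a polynomial in $h$ with rational coefficients of degree $k$. Moreover, $I_{3n+2}$ is a linear combination (with constant coefficients) of several $I_j$ with $j<3n+2$ and $j\not\equiv 2\pmod 3$.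
   Context: The Hamiltonian system is $\dot x=-H_y=-y$, $\dot y=H_x=x+x^2$, which has a center at the origin. For $h\in(0,1/6)$, $\gamma_h$ is the oval of $\{H(x,y)=h\}$ surrounding the origin (contained in $\{x+1>0\}$), oriented by the flow, i.e. counterclockwise. $A(h)$ is the area enclosed by $\gamma_h$ and $T(h)$ is the minimal period of $\gamma_h$. *)

theory Defs
  imports "HOL-Analysis.Analysis" "HOL-Computational_Algebra.Polynomial"
begin

definition ham :: "real \<Rightarrow> real \<Rightarrow> real" where
  "ham x y = x^2 / 2 + y^2 / 2 + x^3 / 3"

text \<open>Sign convention: \<open>x' = - H\<^sub>y\<close>, \<open>y' = H\<^sub>x\<close>, so the ovals around the origin run counterclockwise.\<close>

definition ham_field :: "real \<times> real \<Rightarrow> real \<times> real" where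
  "ham_field = (\<lambda>(x, y). (- deriv (\<lambda>v. ham x v) y, deriv (\<lambda>u. ham u y) x))"

lemma ham_field_eq: "ham_field (x, y) = (- y, x + x^2)"
proof -
  have "((\<lambda>v. ham x v) has_real_derivative y) (at y)"
    unfolding ham_def by (auto intro!: derivative_eq_intros)
  moreover have "((\<lambda>u. ham u y) has_real_derivative x + x^2) (at x)"
    unfolding ham_def by (auto intro!: derivative_eq_intros)
  ultimately show ?thesis
    by (simp add: ham_field_def DERIV_imp_deriv)
qed

definition ham_solution :: "(real \<Rightarrow> real \<times> real) \<Rightarrow> bool" where
  "ham_solution u \<longleftrightarrow> (\<forall>t. (u has_vector_derivative ham_field (u t)) (at t))"

text \<open>The level set also has an unbounded component in \<open>x < -1\<close> when \<open>0 < h < 1/6\<close>;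
  \<open>oval h\<close> is the component that surrounds the origin.\<close>

definition oval :: "real \<Rightarrow> (real \<times> real) set" where
  "oval h = (THE C. C \<in> components {(x, y). ham x y = h} \<and> (0, 0) \<in> inside C)"

definition ham_area :: "real \<Rightarrow> real" where
  "ham_area h = measure lebesgue (inside (oval h))"

definition oval_solution :: "real \<Rightarrow> (real \<Rightarrow> real \<times> real) \<Rightarrow> bool" where
  "oval_solution h u \<longleftrightarrow> ham_solution u \<and> range u = oval h"

definition ham_period :: "real \<Rightarrow> real" where
  "ham_period h = (LEAST \<tau>. \<tau> > 0 \<and> (\<exists>u. oval_solution h u \<and> (\<forall>t. u (t + \<tau>) = u t)))"

text \<open>The line integral of \<open>x\<^sup>j y dx\<close> once around \<open>oval h\<close>, oriented by the flow:
  the oval is parametrized by a solution over one minimal period. Any two such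
  solutions differ by a time shift, so the choice made by \<open>SOME\<close> is immaterial.\<close>

definition ham_integral :: "nat \<Rightarrow> real \<Rightarrow> real" where
  "ham_integral j h = (let u = (SOME u. oval_solution h u) in
     integral {0..ham_period h}
       (\<lambda>t. fst (u t) ^ j * snd (u t) * deriv (\<lambda>s. fst (u s)) t))"

definition rat_poly_eval :: "rat poly \<Rightarrow> real \<Rightarrow> real" where
  "rat_poly_eval q h = poly (map_poly of_rat q) h"

text \<open>The library sets \<open>degree 0 = 0\<close>, hence the explicit exclusion of the zero polynomial.\<close>

definition has_degree :: "rat poly \<Rightarrow> nat \<Rightarrow> bool" where
  "has_degree q k \<longleftrightarrow> q \<noteq> 0 \<and> degree q = k"

end

theory Submission
  imports Defs
begin

text \<open>On \<open>x > -1\<close> the substitution \<open>w = x sqrt (1 + 2 x / 3)\<close> is a diffeomorphism onto its image that turns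
  the Hamiltonian into \<open>(w\<^sup>2 + y\<^sup>2) / 2\<close>. With \<open>r = sqrt (2 h)\<close> the oval is therefore the image of the
  circle \<open>(w, y) = (r cos \<theta>, r sin \<theta>)\<close>, and along the flow \<open>dt = q(w) d\<theta>\<close> with the weight \<open>q = dx/dw\<close>.
  So \<open>T\<close> is the integral of \<open>q(r cos \<theta>)\<close>, and both \<open>A\<close> and \<open>- I\<^sub>j\<close> are integrals of
  \<open>y\<^sup>2 F(r cos \<theta>)\<close> with \<open>F = x\<^sup>j q\<close>. Differentiating under the integral sign and integrating by parts,
  the \<open>h\<close>-derivative of such an integral is the integral of \<open>F(r cos \<theta>)\<close>; in particular \<open>A' = T\<close>.
  Integrating \<open>d(x\<^sup>k y)\<close> over the oval gives the recurrence
  \<open>(2 k + 9) I\<^bsub>k+2\<^esub> = 3 (2 h k I\<^bsub>k-1\<^esub> - (k + 3) I\<^bsub>k+1\<^esub>)\<close> and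
  \<open>7 I\<^sub>1 = (6 - 30 h) A + 6 h (6 h - 1) T\<close>; differentiating the latter yields the equation for \<open>T'\<close>.\<close>

subsection \<open>The straightening coordinate\<close>

lemma has_real_derivative_inverse:
  fixes f g :: "real \<Rightarrow> real"
  assumes "(f has_real_derivative D) (at x)" "D \<noteq> 0" "continuous_on S f" "open S" "x \<in> S"
    and "\<And>z. z \<in> S \<Longrightarrow> g (f z) = z"
  shows "(g has_real_derivative inverse D) (at (f x))"
  unfolding has_field_derivative_def
proof (rule has_derivative_inverse_strong[OF assms(4,5,3)])
  show "(f has_derivative (*) D) (at x)" using assms(1) by (simp add: has_field_derivative_def)
  show "(*) D \<circ> (*) (inverse D) = id" using assms(2) by (simp add: fun_eq_iff)
qed (use assms(6) in auto)

definition wcoord :: "real \<Rightarrow> real" where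
  "wcoord x = x * sqrt (1 + 2 * x / 3)"

definition xcoord :: "real \<Rightarrow> real" where
  "xcoord = inv_into {-1<..<1} wcoord"

definition weight :: "real \<Rightarrow> real" where
  "weight w = sqrt (1 + 2 * xcoord w / 3) / (1 + xcoord w)"

lemma wcoord_square:
  assumes "x \<ge> -1"
  shows "(wcoord x)\<^sup>2 = x^2 + 2 * x^3 / 3"
  using assms by (simp add: wcoord_def power_mult_distrib field_simps power2_eq_square power3_eq_cube)

lemma ham_eq_wcoord:
  assumes "x \<ge> -1"
  shows "ham x y = ((wcoord x)\<^sup>2 + y\<^sup>2) / 2"
  using wcoord_square[OF assms] by (simp add: ham_def)

lemma wcoord_has_derivative:
  assumes "x > -1"
  shows "(wcoord has_real_derivative (1 + x) / sqrt (1 + 2 * x / 3)) (at x)"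
proof -
  have p: "1 + 2 * x / 3 > 0" using assms by simp
  have s: "sqrt (1 + 2 * x / 3) * sqrt (1 + 2 * x / 3) = 1 + 2 * x / 3"
    using p by simp
  have "((\<lambda>x. x * sqrt (1 + 2 * x / 3)) has_real_derivative
      sqrt (1 + 2 * x / 3) + x * ((2/3) * (inverse (sqrt (1 + 2 * x / 3)) / 2))) (at x)"
    using p by (auto intro!: derivative_eq_intros simp: field_simps)
  moreover have "sqrt (1 + 2 * x / 3) + x * ((2/3) * (inverse (sqrt (1 + 2 * x / 3)) / 2))
      = (1 + x) / sqrt (1 + 2 * x / 3)"
    using p s by (simp add: field_simps del: real_sqrt_mult_self)
  ultimately show ?thesis unfolding wcoord_def[abs_def] by simp
qed

lemma wcoord_continuous_on: "continuous_on S wcoord"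
  unfolding wcoord_def[abs_def] by (intro continuous_intros) auto

lemma wcoord_strict_mono:
  assumes "-1 \<le> x" "x < y"
  shows "wcoord x < wcoord y"
proof (rule DERIV_pos_imp_increasing_open[OF assms(2)])
  fix z assume "x < z" "z < y"
  then have "z > -1" using assms by simp
  then show "\<exists>D. (wcoord has_real_derivative D) (at z) \<and> D > 0"
    using wcoord_has_derivative[of z] by (intro exI[of _ "(1 + z) / sqrt (1 + 2 * z / 3)"]) auto
qed (rule wcoord_continuous_on)

lemma inj_on_wcoord: "inj_on wcoord {-1..}"
  by (intro linorder_inj_onI) (use wcoord_strict_mono in force)+

lemma wcoord_minus_one: "wcoord (-1) = - sqrt (1/3)"
  by (simp add: wcoord_def)

lemma wcoord_one: "wcoord 1 > sqrt (1/3)"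
  by (simp add: wcoord_def)

lemma wcoord_surj:
  assumes "\<bar>w\<bar> < sqrt (1/3)"
  shows "w \<in> wcoord ` {-1<..<1}"
proof -
  have "\<exists>x\<ge>-1. x \<le> 1 \<and> wcoord x = w"
    using assms wcoord_minus_one wcoord_one by (intro IVT' wcoord_continuous_on) auto
  then obtain x where x: "-1 \<le> x" "x \<le> 1" "wcoord x = w" by blast
  moreover have "x \<noteq> -1" "x \<noteq> 1" using x assms wcoord_minus_one wcoord_one by auto
  ultimately show ?thesis by (intro image_eqI[of _ _ x]) auto
qed

lemma xcoord_bounds:
  assumes "\<bar>w\<bar> < sqrt (1/3)"
  shows "-1 < xcoord w" "xcoord w < 1"
  using inv_into_into[OF wcoord_surj[OF assms]] by (auto simp: xcoord_def)

lemma wcoord_xcoord: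
  assumes "\<bar>w\<bar> < sqrt (1/3)"
  shows "wcoord (xcoord w) = w"
  using f_inv_into_f[OF wcoord_surj[OF assms]] by (simp add: xcoord_def)

lemma xcoord_wcoord:
  assumes "-1 < x" "x < 1"
  shows "xcoord (wcoord x) = x"
  unfolding xcoord_def using assms
  by (intro inv_into_f_f inj_on_subset[OF inj_on_wcoord]) auto

lemma weight_pos:
  assumes "\<bar>w\<bar> < sqrt (1/3)"
  shows "weight w > 0"
  using xcoord_bounds[OF assms] by (simp add: weight_def)

lemma weight_lower_bound:
  assumes "\<bar>w\<bar> < sqrt (1/3)"
  shows "weight w \<ge> sqrt (1/3) / 2"
proof -
  note b = xcoord_bounds[OF assms]
  have "sqrt (1/3) / 2 \<le> sqrt (1 + 2 * xcoord w / 3) / (1 + xcoord w)"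
    using b by (intro frac_le real_sqrt_le_mono) auto
  then show ?thesis by (simp add: weight_def)
qed

lemma weight_ode:
  assumes "\<bar>w\<bar> < sqrt (1/3)"
  shows "weight w * (xcoord w + (xcoord w)\<^sup>2) = w"
proof -
  have "weight w * (xcoord w + (xcoord w)\<^sup>2) = wcoord (xcoord w)"
    using xcoord_bounds[OF assms] by (simp add: weight_def wcoord_def power2_eq_square field_simps)
  then show ?thesis using wcoord_xcoord[OF assms] by simp
qed

lemma xcoord_has_derivative:
  assumes "\<bar>w\<bar> < sqrt (1/3)"
  shows "(xcoord has_real_derivative weight w) (at w)"
proof -
  note b = xcoord_bounds[OF assms]
  have "(xcoord has_real_derivative inverse ((1 + xcoord w) / sqrt (1 + 2 * xcoord w / 3)))
     (at (wcoord (xcoord w)))"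
    by (rule has_real_derivative_inverse[OF wcoord_has_derivative _ wcoord_continuous_on,
          where S = "{-1<..<1}"]) (use b xcoord_wcoord in auto)
  then show ?thesis by (simp add: wcoord_xcoord[OF assms] weight_def)
qed

subsection \<open>Integrals over the oval\<close>

definition oval_moment :: "(real \<Rightarrow> real) \<Rightarrow> real \<Rightarrow> real" where
  "oval_moment F h = integral {-pi..pi} (\<lambda>\<theta>. F (sqrt (2 * h) * cos \<theta>))"

definition oval_flux :: "(real \<Rightarrow> real) \<Rightarrow> real \<Rightarrow> real" where
  "oval_flux F h = integral {-pi..pi} (\<lambda>\<theta>. 2 * h * (sin \<theta>)\<^sup>2 * F (sqrt (2 * h) * cos \<theta>))"

lemma level_cos_bound:
  assumes "0 < h" "h < 1/6"
  shows "\<bar>sqrt (2 * h) * cos \<theta>\<bar> < sqrt (1/3)"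
proof -
  have "\<bar>sqrt (2 * h) * cos \<theta>\<bar> \<le> sqrt (2 * h) * 1"
    unfolding abs_mult using assms by (intro mult_mono) auto
  also have "\<dots> < sqrt (1/3)" using assms by simp
  finally show ?thesis .
qed

lemma continuous_on_level_cos:
  assumes "continuous_on {w. \<bar>w\<bar> < sqrt (1/3)} F" "0 < h" "h < 1/6"
  shows "continuous_on S (\<lambda>\<theta>. F (sqrt (2 * h) * cos \<theta>))"
  by (rule continuous_on_compose2[OF assms(1)])
    (use level_cos_bound[OF assms(2,3)] in \<open>auto intro!: continuous_intros\<close>)

lemma oval_flux_has_derivative:
  assumes F: "\<And>w. \<bar>w\<bar> < sqrt (1/3) \<Longrightarrow> (F has_real_derivative F' w) (at w)"
    and F': "continuous_on {w. \<bar>w\<bar> < sqrt (1/3)} F'"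
    and h: "0 < h" "h < 1/6"
  shows "(oval_flux F has_real_derivative oval_moment F h) (at h)"
proof -
  let ?U = "{0<..<1/6::real}"
  let ?g = "\<lambda>h \<theta>. 2 * h * (sin \<theta>)\<^sup>2 * F (sqrt (2 * h) * cos \<theta>)"
  let ?g' = "\<lambda>h \<theta>. 2 * (sin \<theta>)\<^sup>2 * F (sqrt (2 * h) * cos \<theta>)
     + sqrt (2 * h) * (sin \<theta>)\<^sup>2 * cos \<theta> * F' (sqrt (2 * h) * cos \<theta>)"
  have contF: "continuous_on {w. \<bar>w\<bar> < sqrt (1/3)} F"
    by (rule DERIV_continuous_on[of _ F F', OF has_field_derivative_at_within[OF F]]) auto
  have pair: "continuous_on (?U \<times> cbox (-pi) pi) (\<lambda>(h, \<theta>). sqrt (2 * h) * cos \<theta>)"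
    by (auto simp: case_prod_beta intro!: continuous_intros)
  have img: "(\<lambda>(h, \<theta>). sqrt (2 * h) * cos \<theta>) ` (?U \<times> cbox (-pi) pi) \<subseteq> {w. \<bar>w\<bar> < sqrt (1/3)}"
    using level_cos_bound by auto
  have pairF: "continuous_on (?U \<times> cbox (-pi) pi) (\<lambda>x. F (sqrt (2 * fst x) * cos (snd x)))"
    using continuous_on_compose2[OF contF pair img] by (simp add: case_prod_beta)
  have pairF': "continuous_on (?U \<times> cbox (-pi) pi) (\<lambda>x. F' (sqrt (2 * fst x) * cos (snd x)))"
    using continuous_on_compose2[OF F' pair img] by (simp add: case_prod_beta)
  have "((\<lambda>h. integral (cbox (-pi) pi) (?g h)) has_field_derivative integral (cbox (-pi) pi) (?g' h))
      (at h within ?U)"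
  proof (rule leibniz_rule_field_derivative)
    show "continuous_on (?U \<times> cbox (-pi) pi) (\<lambda>(h, \<theta>). ?g' h \<theta>)"
      unfolding case_prod_beta by (intro continuous_intros pairF pairF')
  next
    fix h \<theta> :: real assume h: "h \<in> ?U"
    have s: "((\<lambda>h. sqrt (2 * h) * cos \<theta>) has_real_derivative cos \<theta> / sqrt (2 * h)) (at h)"
      using h by (auto intro!: derivative_eq_intros simp: field_simps)
    have "((\<lambda>h. F (sqrt (2 * h) * cos \<theta>)) has_real_derivative
        F' (sqrt (2 * h) * cos \<theta>) * (cos \<theta> / sqrt (2 * h))) (at h)"
      by (rule DERIV_chain2[OF F s]) (use h level_cos_bound in auto)
    then have "((\<lambda>h. ?g h \<theta>) has_real_derivative
        2 * h * (sin \<theta>)\<^sup>2 * (F' (sqrt (2 * h) * cos \<theta>) * (cos \<theta> / sqrt (2 * h)))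
        + 2 * (sin \<theta>)\<^sup>2 * F (sqrt (2 * h) * cos \<theta>)) (at h)"
      by (auto intro!: derivative_eq_intros)
    moreover have "2 * h * (sin \<theta>)\<^sup>2 * (F' (sqrt (2 * h) * cos \<theta>) * (cos \<theta> / sqrt (2 * h)))
        = (2 * h / sqrt (2 * h)) * (sin \<theta>)\<^sup>2 * cos \<theta> * F' (sqrt (2 * h) * cos \<theta>)"
      by simp
    moreover have "2 * h / sqrt (2 * h) = sqrt (2 * h)"
      using h by (intro real_div_sqrt) auto
    ultimately show "((\<lambda>h. ?g h \<theta>) has_real_derivative ?g' h \<theta>) (at h within ?U)"
      by (simp add: add.commute has_field_derivative_at_within)
  next
    fix h :: real assume "h \<in> ?U"
    then show "?g h integrable_on cbox (-pi) pi"
      by (intro integrable_continuous continuous_intros continuous_on_level_cos contF) auto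
  qed (use h in auto)
  then have D: "(oval_flux F has_real_derivative integral {-pi..pi} (?g' h)) (at h)"
    using h by (simp add: oval_flux_def[abs_def] at_within_open[of h ?U])
  let ?k = "\<lambda>\<theta>. F (sqrt (2 * h) * cos \<theta>) * (sin \<theta> * cos \<theta>)"
  have "((\<lambda>\<theta>. F (sqrt (2 * h) * cos \<theta>) - ?g' h \<theta>) has_integral ?k pi - ?k (-pi)) {-pi..pi}"
  proof (rule fundamental_theorem_of_calculus)
    fix \<theta> :: real
    have s: "((\<lambda>\<theta>. sqrt (2 * h) * cos \<theta>) has_real_derivative - sqrt (2 * h) * sin \<theta>) (at \<theta>)"
      by (auto intro!: derivative_eq_intros)
    have "((\<lambda>\<theta>. F (sqrt (2 * h) * cos \<theta>)) has_real_derivative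
        F' (sqrt (2 * h) * cos \<theta>) * (- sqrt (2 * h) * sin \<theta>)) (at \<theta>)"
      by (rule DERIV_chain2[OF F s]) (use h level_cos_bound in auto)
    then have "(?k has_real_derivative F (sqrt (2 * h) * cos \<theta>) * (cos \<theta> * cos \<theta> - sin \<theta> * sin \<theta>)
        + F' (sqrt (2 * h) * cos \<theta>) * (- sqrt (2 * h) * sin \<theta>) * (sin \<theta> * cos \<theta>)) (at \<theta>)"
      by (auto intro!: derivative_eq_intros simp: algebra_simps)
    moreover have "cos \<theta> * cos \<theta> - sin \<theta> * sin \<theta> = 1 - 2 * (sin \<theta>)\<^sup>2"
      using sin_cos_squared_add[of \<theta>] by (simp add: power2_eq_square)
    ultimately have "(?k has_real_derivative F (sqrt (2 * h) * cos \<theta>) - ?g' h \<theta>) (at \<theta>)"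
      by (simp add: algebra_simps power2_eq_square)
    then show "(?k has_vector_derivative F (sqrt (2 * h) * cos \<theta>) - ?g' h \<theta>) (at \<theta> within {-pi..pi})"
      by (simp add: has_real_derivative_iff_has_vector_derivative has_vector_derivative_at_within)
  qed simp
  moreover have "(\<lambda>\<theta>. F (sqrt (2 * h) * cos \<theta>)) integrable_on {-pi..pi}" "?g' h integrable_on {-pi..pi}"
    using h by (auto intro!: integrable_continuous_interval continuous_intros continuous_on_level_cos contF F')
  ultimately have "integral {-pi..pi} (?g' h) = oval_moment F h"
    by (simp add: oval_moment_def has_integral_iff integral_diff)
  with D show ?thesis by simp
qed

lemma continuous_on_xcoord: "continuous_on {w. \<bar>w\<bar> < sqrt (1/3)} xcoord"
  by (rule DERIV_continuous_on[of _ xcoord weight, OF has_field_derivative_at_within[OF xcoord_has_derivative]])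
    auto

lemma continuous_on_weight: "continuous_on {w. \<bar>w\<bar> < sqrt (1/3)} weight"
  unfolding weight_def[abs_def]
  by (intro continuous_intros continuous_on_xcoord)
    (use xcoord_bounds(1) in force)+

definition xmoment :: "nat \<Rightarrow> real \<Rightarrow> real" where
  "xmoment j = oval_moment (\<lambda>w. xcoord w ^ j * weight w)"

definition xflux :: "nat \<Rightarrow> real \<Rightarrow> real" where
  "xflux j = oval_flux (\<lambda>w. xcoord w ^ j * weight w)"

lemma xflux_has_derivative:
  assumes h: "0 < h" "h < 1/6"
  shows "(xflux j has_real_derivative xmoment j h) (at h)"
  unfolding xflux_def xmoment_def
proof (rule oval_flux_has_derivative[OF _ _ h])
  define G :: "real \<Rightarrow> real" where "G x = x ^ j * (sqrt (1 + 2 * x / 3) / (1 + x))" for x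
  define G' :: "real \<Rightarrow> real" where "G' x = ((real j * x ^ (j - 1) * sqrt (1 + 2 * x / 3)
      + inverse (sqrt (1 + 2 * x / 3)) * x ^ j / 3) * (1 + x) - x ^ j * sqrt (1 + 2 * x / 3)) / ((1 + x) * (1 + x))" for x
  have G: "(G has_real_derivative G' x) (at x)" if "x > -1" for x
    unfolding G_def[abs_def] G'_def using that
    by (auto intro!: derivative_eq_intros)
  show "((\<lambda>w. xcoord w ^ j * weight w) has_real_derivative G' (xcoord w) * weight w) (at w)"
    if w: "\<bar>w\<bar> < sqrt (1/3)" for w
    using DERIV_chain2[OF G xcoord_has_derivative[OF w]] xcoord_bounds[OF w]
    by (simp add: G_def weight_def)
  show "continuous_on {w. \<bar>w\<bar> < sqrt (1/3)} (\<lambda>w. G' (xcoord w) * weight w)"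
    unfolding G'_def
    by (intro continuous_intros continuous_on_xcoord continuous_on_weight)
       (use xcoord_bounds(1) in force)+
qed

lemma xmoment_integral:
  "xmoment j h = integral {-pi..pi} (\<lambda>\<theta>. xcoord (sqrt (2 * h) * cos \<theta>) ^ j * weight (sqrt (2 * h) * cos \<theta>))"
  by (simp add: xmoment_def oval_moment_def)

lemma xflux_integral:
  "xflux j h = integral {-pi..pi} (\<lambda>\<theta>. 2 * h * (sin \<theta>)\<^sup>2 *
     (xcoord (sqrt (2 * h) * cos \<theta>) ^ j * weight (sqrt (2 * h) * cos \<theta>)))"
  by (simp add: xflux_def oval_flux_def)

context
  fixes h :: real
  assumes h: "0 < h" "h < 1/6"
begin

lemma xmoment_has_integral:
  "((\<lambda>\<theta>. xcoord (sqrt (2 * h) * cos \<theta>) ^ j * weight (sqrt (2 * h) * cos \<theta>))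
     has_integral xmoment j h) {-pi..pi}"
  unfolding xmoment_integral
  by (intro integrable_integral integrable_continuous_interval continuous_intros
      continuous_on_level_cos continuous_on_xcoord continuous_on_weight h)

lemma xflux_has_integral:
  "((\<lambda>\<theta>. 2 * h * (sin \<theta>)\<^sup>2 * (xcoord (sqrt (2 * h) * cos \<theta>) ^ j * weight (sqrt (2 * h) * cos \<theta>)))
     has_integral xflux j h) {-pi..pi}"
  unfolding xflux_integral
  by (intro integrable_integral integrable_continuous_interval continuous_intros
      continuous_on_level_cos continuous_on_xcoord continuous_on_weight h)

lemma level_equation:
  "2 * h * (sin \<theta>)\<^sup>2 = 2 * h - xcoord (sqrt (2 * h) * cos \<theta>) ^ 2 - 2 / 3 * xcoord (sqrt (2 * h) * cos \<theta>) ^ 3"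
proof -
  let ?w = "sqrt (2 * h) * cos \<theta>"
  have b: "\<bar>?w\<bar> < sqrt (1/3)" by (rule level_cos_bound[OF h])
  have "xcoord ?w ^ 2 + 2 * xcoord ?w ^ 3 / 3 = ?w\<^sup>2"
    using wcoord_square[of "xcoord ?w"] xcoord_bounds[OF b] wcoord_xcoord[OF b] by simp
  also have "\<dots> = 2 * h * (1 - (sin \<theta>)\<^sup>2)"
    using h by (simp add: power_mult_distrib cos_squared_eq)
  finally show ?thesis by (simp add: algebra_simps)
qed

lemma xflux_eq_xmoment: "xflux j h = 2 * h * xmoment j h - xmoment (j + 2) h - 2 / 3 * xmoment (j + 3) h"
proof (rule has_integral_unique[OF xflux_has_integral])
  have "((\<lambda>\<theta>. 2 * h * (xcoord (sqrt (2 * h) * cos \<theta>) ^ j * weight (sqrt (2 * h) * cos \<theta>))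
      - xcoord (sqrt (2 * h) * cos \<theta>) ^ (j + 2) * weight (sqrt (2 * h) * cos \<theta>)
      - 2 / 3 * (xcoord (sqrt (2 * h) * cos \<theta>) ^ (j + 3) * weight (sqrt (2 * h) * cos \<theta>)))
      has_integral 2 * h * xmoment j h - xmoment (j + 2) h - 2 / 3 * xmoment (j + 3) h) {-pi..pi}"
    by (intro has_integral_diff has_integral_mult_right xmoment_has_integral)
  then show "((\<lambda>\<theta>. 2 * h * (sin \<theta>)\<^sup>2 * (xcoord (sqrt (2 * h) * cos \<theta>) ^ j * weight (sqrt (2 * h) * cos \<theta>)))
     has_integral 2 * h * xmoment j h - xmoment (j + 2) h - 2 / 3 * xmoment (j + 3) h) {-pi..pi}"
    unfolding level_equation by (simp add: algebra_simps power_add power2_eq_square power3_eq_cube)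
qed

lemma xcoord_level_has_derivative:
  "((\<lambda>\<theta>. xcoord (sqrt (2 * h) * cos \<theta>)) has_real_derivative
     - (weight (sqrt (2 * h) * cos \<theta>) * (sqrt (2 * h) * sin \<theta>))) (at \<theta>)"
proof -
  have "((\<lambda>\<theta>. sqrt (2 * h) * cos \<theta>) has_real_derivative - (sqrt (2 * h) * sin \<theta>)) (at \<theta>)"
    by (auto intro!: derivative_eq_intros)
  from DERIV_chain2[OF xcoord_has_derivative[OF level_cos_bound[OF h]] this] show ?thesis by simp
qed

text \<open>The relation expresses that the exact form \<open>d(x\<^sup>k y)\<close> integrates to zero over the oval.\<close>

lemma xmoment_flux_relation: "real k * xflux (k - 1) h = xmoment (k + 1) h + xmoment (k + 2) h"
proof -
  let ?x = "\<lambda>\<theta>. xcoord (sqrt (2 * h) * cos \<theta>)" and ?q = "\<lambda>\<theta>. weight (sqrt (2 * h) * cos \<theta>)"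
  let ?F = "\<lambda>\<theta>. ?x \<theta> ^ k * (sqrt (2 * h) * sin \<theta>)"
  let ?f = "\<lambda>\<theta>. ?x \<theta> ^ (k + 1) * ?q \<theta> + ?x \<theta> ^ (k + 2) * ?q \<theta>
      - real k * (2 * h * (sin \<theta>)\<^sup>2 * (?x \<theta> ^ (k - 1) * ?q \<theta>))"
  have "(?f has_integral ?F pi - ?F (-pi)) {-pi..pi}"
  proof (rule fundamental_theorem_of_calculus)
    fix \<theta> :: real
    have "(?F has_real_derivative real k * ?x \<theta> ^ (k - 1) * (- (?q \<theta> * (sqrt (2 * h) * sin \<theta>))) * (sqrt (2 * h) * sin \<theta>)
       + ?x \<theta> ^ k * (sqrt (2 * h) * cos \<theta>)) (at \<theta>)"
      using xcoord_level_has_derivative[of \<theta>] by (auto intro!: derivative_eq_intros)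
    moreover have "real k * ?x \<theta> ^ (k - 1) * (- (?q \<theta> * (sqrt (2 * h) * sin \<theta>))) * (sqrt (2 * h) * sin \<theta>)
        = - (real k * (2 * h * (sin \<theta>)\<^sup>2 * (?x \<theta> ^ (k - 1) * ?q \<theta>)))"
    proof -
      have "real k * ?x \<theta> ^ (k - 1) * (- (?q \<theta> * (sqrt (2 * h) * sin \<theta>))) * (sqrt (2 * h) * sin \<theta>)
        = - (real k * ((sqrt (2 * h))\<^sup>2 * (sin \<theta>)\<^sup>2 * (?x \<theta> ^ (k - 1) * ?q \<theta>)))"
        by (simp add: power2_eq_square)
      also have "(sqrt (2 * h))\<^sup>2 = 2 * h" using h by simp
      finally show ?thesis .
    qed
    moreover have "?x \<theta> ^ k * (sqrt (2 * h) * cos \<theta>) = ?x \<theta> ^ (k + 1) * ?q \<theta> + ?x \<theta> ^ (k + 2) * ?q \<theta>"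
    proof -
      have "?x \<theta> ^ k * (sqrt (2 * h) * cos \<theta>) = ?x \<theta> ^ k * (?q \<theta> * (?x \<theta> + (?x \<theta>)\<^sup>2))"
        using weight_ode[OF level_cos_bound[OF h, of \<theta>]] by (simp only:)
      then show ?thesis by (simp add: algebra_simps power2_eq_square)
    qed
    ultimately have "(?F has_real_derivative ?f \<theta>) (at \<theta>)" by (simp only: uminus_add_conv_diff)
    then show "(?F has_vector_derivative ?f \<theta>) (at \<theta> within {-pi..pi})"
      by (simp add: has_real_derivative_iff_has_vector_derivative has_vector_derivative_at_within)
  qed simp
  then have "(?f has_integral 0) {-pi..pi}" by simp
  moreover have "(?f has_integral xmoment (k + 1) h + xmoment (k + 2) h - real k * xflux (k - 1) h) {-pi..pi}"
    by (intro has_integral_diff has_integral_add has_integral_mult_right xmoment_has_integral xflux_has_integral)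
  ultimately have "0 = xmoment (k + 1) h + xmoment (k + 2) h - real k * xflux (k - 1) h"
    by (rule has_integral_unique)
  then show ?thesis by simp
qed

lemma xflux_recurrence:
  "(2 * real k + 9) * xflux (k + 2) h = 3 * (2 * h * real k * xflux (k - 1) h - (real k + 3) * xflux (k + 1) h)"
proof -
  have "2 * h * (real k * xflux (k - 1) h) = 2 * h * xmoment (k + 1) h + 2 * h * xmoment (k + 2) h"
    using xmoment_flux_relation[of k] by (simp add: algebra_simps)
  then show ?thesis
    using xflux_eq_xmoment[of "k + 1"] xflux_eq_xmoment[of "k + 2"]
      xmoment_flux_relation[of "k + 2"] xmoment_flux_relation[of "k + 3"]
    by (simp add: algebra_simps numeral_eq_Suc)
qed

lemma xmoment_1: "xmoment 1 h = 5 * xflux 0 h - 6 * h * xmoment 0 h"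
  using xflux_eq_xmoment[of 0] xmoment_flux_relation[of 0] xmoment_flux_relation[of 1]
  by (simp add: algebra_simps numeral_eq_Suc)

lemma xflux_1: "7 * xflux 1 h = (30 * h - 6) * xflux 0 h - 6 * h * (6 * h - 1) * xmoment 0 h"
proof -
  have "7 * xflux 1 h = (6 * h - 1) * xmoment 1 h - xflux 0 h"
    using xflux_eq_xmoment[of 1]
      xmoment_flux_relation[of 0] xmoment_flux_relation[of 1] xmoment_flux_relation[of 2]
    by (simp add: algebra_simps numeral_eq_Suc)
  then show ?thesis unfolding xmoment_1 by (simp add: algebra_simps)
qed

end

lemma xmoment_0_has_derivative:
  assumes h: "0 < h" "h < 1/6"
  shows "(xmoment 0 has_real_derivative - 5 * xflux 0 h / (6 * h * (6 * h - 1))) (at h)"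
proof -
  let ?T = "\<lambda>h. ((30 * h - 6) * xflux 0 h - 7 * xflux 1 h) / (6 * h * (6 * h - 1))"
  note M1 = xmoment_1[OF h]
  have eq: "xmoment 0 x = ?T x" if "x \<in> {0<..<1/6}" for x
    using xflux_1[of x] that by (simp add: field_simps)
  have nz: "6 * h * (6 * h - 1) \<noteq> 0" using h by simp
  note xflux_has_derivative[OF h, of 0] xflux_has_derivative[OF h, of 1]
  then have "(?T has_real_derivative
     (((30 * h - 6) * xmoment 0 h + 30 * xflux 0 h - 7 * xmoment 1 h) * (6 * h * (6 * h - 1))
      - ((30 * h - 6) * xflux 0 h - 7 * xflux 1 h) * (72 * h - 6)) / (6 * h * (6 * h - 1))\<^sup>2) (at h)"
    using nz by (auto intro!: derivative_eq_intros simp: power2_eq_square algebra_simps)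
  moreover have "(30 * h - 6) * xflux 0 h - 7 * xflux 1 h = xmoment 0 h * (6 * h * (6 * h - 1))"
    using xflux_1[OF h] by (simp add: algebra_simps)
  ultimately have "(?T has_real_derivative
     (((30 * h - 6) * xmoment 0 h + 30 * xflux 0 h - 7 * xmoment 1 h) * (6 * h * (6 * h - 1))
      - xmoment 0 h * (6 * h * (6 * h - 1)) * (72 * h - 6)) / (6 * h * (6 * h - 1))\<^sup>2) (at h)"
    by simp
  moreover have "((30 * h - 6) * xmoment 0 h + 30 * xflux 0 h - 7 * xmoment 1 h) * (6 * h * (6 * h - 1))
      - xmoment 0 h * (6 * h * (6 * h - 1)) * (72 * h - 6) = - 5 * xflux 0 h * (6 * h * (6 * h - 1))"
    unfolding M1 by (simp add: algebra_simps)
  moreover have "- 5 * xflux 0 h * (6 * h * (6 * h - 1)) / (6 * h * (6 * h - 1))\<^sup>2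
      = - 5 * xflux 0 h / (6 * h * (6 * h - 1))"
    using nz by (simp add: power2_eq_square)
  ultimately have "(?T has_real_derivative - 5 * xflux 0 h / (6 * h * (6 * h - 1))) (at h)" by simp
  then show ?thesis
    by (rule has_field_derivative_transform_within_open[of _ _ _ "{0<..<1/6}"]) (use h eq in auto)
qed

subsection \<open>Topology of the oval\<close>

lemma inside_meets_ray:
  fixes p v :: "'a::real_normed_vector"
  assumes "p \<in> inside K" "v \<noteq> 0"
  shows "\<exists>t\<ge>0. p + t *\<^sub>R v \<in> K"
proof (rule ccontr)
  assume "\<not> ?thesis"
  then have sub: "(\<lambda>t. p + t *\<^sub>R v) ` {0..} \<subseteq> - K" by auto
  have "connected ((\<lambda>t. p + t *\<^sub>R v) ` {0..})"
    by (intro connected_continuous_image continuous_intros connected_Ici)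
  moreover have "p \<in> (\<lambda>t. p + t *\<^sub>R v) ` {0..}" by (auto intro: image_eqI[of _ _ 0])
  ultimately have "(\<lambda>t. p + t *\<^sub>R v) ` {0..} \<subseteq> connected_component_set (- K) p"
    using sub by (intro connected_component_maximal)
  then have "bounded ((\<lambda>t. p + t *\<^sub>R v) ` {0..})"
    using assms(1) bounded_subset by (auto simp: inside_def)
  then obtain B where B: "\<And>t. t \<ge> 0 \<Longrightarrow> norm (p + t *\<^sub>R v) \<le> B" by (auto simp: bounded_iff)
  define t where "t = (B + norm p + 1) / norm v"
  have "B \<ge> 0" using order_trans[OF norm_ge_zero B[of 0]] by simp
  then have "t \<ge> 0" by (simp add: t_def)
  have "norm (t *\<^sub>R v) = B + norm p + 1"
    using assms(2) \<open>B \<ge> 0\<close> by (simp add: t_def)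
  moreover have "norm (t *\<^sub>R v) \<le> norm (p + t *\<^sub>R v) + norm p"
    using norm_triangle_ineq4[of "p + t *\<^sub>R v" p] by simp
  ultimately show False using B[OF \<open>t \<ge> 0\<close>] by simp
qed

definition oval_interior :: "real \<Rightarrow> (real \<times> real) set" where
  "oval_interior h = {(x, y). -1 < x \<and> ham x y < h}"

definition oval_point :: "real \<Rightarrow> real \<Rightarrow> real \<times> real" where
  "oval_point h \<theta> = (xcoord (sqrt (2 * h) * cos \<theta>), sqrt (2 * h) * sin \<theta>)"

lemma ham_ge_at_left:
  "ham (-1) y \<ge> 1/6"
  by (simp add: ham_def)

lemma continuous_on_ham: "continuous_on S (\<lambda>p. ham (fst p) (snd p))"
  unfolding ham_def by (intro continuous_intros) auto

context
  fixes h :: real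
  assumes h: "0 < h" "h < 1/6"
begin

lemma ham_bound:
  assumes "-1 < x" "ham x y \<le> h"
  shows "x < 1" "\<bar>y\<bar> < 1"
proof -
  have sq: "(wcoord x)\<^sup>2 + y\<^sup>2 < 1/3"
    using assms h ham_eq_wcoord[of x y] by simp
  show "x < 1"
  proof (rule ccontr)
    assume "\<not> x < 1"
    then have "1 \<le> x\<^sup>2" "0 \<le> x^3" by (auto intro: one_le_power)
    moreover have "0 \<le> y\<^sup>2" by simp
    ultimately show False using sq wcoord_square[of x] assms(1) by linarith
  qed
  have "0 \<le> (wcoord x)\<^sup>2" by simp
  then have "y\<^sup>2 < 1" using sq by linarith
  then show "\<bar>y\<bar> < 1" by (simp add: abs_square_less_1)
qed

lemma range_oval_point: "range (oval_point h) = {(x, y). -1 < x \<and> ham x y = h}"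
proof (intro subset_antisym subsetI)
  fix p assume "p \<in> range (oval_point h)"
  then obtain \<theta> where p: "p = oval_point h \<theta>" by blast
  let ?w = "sqrt (2 * h) * cos \<theta>"
  note b = level_cos_bound[OF h, of \<theta>]
  have "ham (xcoord ?w) (sqrt (2 * h) * sin \<theta>) = (?w\<^sup>2 + (sqrt (2 * h) * sin \<theta>)\<^sup>2) / 2"
    using ham_eq_wcoord[of "xcoord ?w"] xcoord_bounds[OF b] by (simp add: wcoord_xcoord[OF b])
  also have "\<dots> = h * ((sin \<theta>)\<^sup>2 + (cos \<theta>)\<^sup>2)"
    using h by (simp add: power_mult_distrib algebra_simps del: sin_cos_squared_add sin_cos_squared_add2)
  finally show "p \<in> {(x, y). -1 < x \<and> ham x y = h}"
    using xcoord_bounds[OF b] by (simp add: p oval_point_def)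
next
  fix p assume "p \<in> {(x, y). -1 < x \<and> ham x y = h}"
  then obtain x y where p: "p = (x, y)" "-1 < x" "ham x y = h" by auto
  have "(wcoord x / sqrt (2 * h))\<^sup>2 + (y / sqrt (2 * h))\<^sup>2 = ((wcoord x)\<^sup>2 + y\<^sup>2) / (2 * h)"
    using h by (simp add: power_divide add_divide_distrib)
  also have "\<dots> = 1" using ham_eq_wcoord[of x y] p h by simp
  finally obtain \<theta> where "wcoord x / sqrt (2 * h) = cos \<theta>" "y / sqrt (2 * h) = sin \<theta>"
    by (rule sincos_total_2pi)
  then have "wcoord x = sqrt (2 * h) * cos \<theta>" "y = sqrt (2 * h) * sin \<theta>"
    using h by (auto simp: field_simps)
  moreover have "xcoord (wcoord x) = x"
    using p ham_bound[of x y] by (intro xcoord_wcoord) auto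
  ultimately show "p \<in> range (oval_point h)" using p(1) by (auto simp: oval_point_def)
qed

lemma continuous_on_oval_point: "continuous_on S (oval_point h)"
  unfolding oval_point_def[abs_def]
  by (intro continuous_intros continuous_on_level_cos continuous_on_xcoord h)

lemma level_right_component: "{(x, y). -1 < x \<and> ham x y = h} \<in> components {(x, y). ham x y = h}"
proof -
  let ?K = "{(x, y). -1 < x \<and> ham x y = h}" and ?S = "{(x, y). ham x y = h}"
  have conn: "connected ?K"
    unfolding range_oval_point[symmetric]
    by (rule connected_continuous_image[OF continuous_on_oval_point connected_UNIV])
  have ne: "?K \<noteq> {}" unfolding range_oval_point[symmetric] by simp
  show ?thesis
    unfolding in_components_maximal
  proof (intro conjI allI impI ne conn)
    fix D assume D: "D \<noteq> {} \<and> ?K \<subseteq> D \<and> D \<subseteq> ?S \<and> connected D"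
    have "{p. fst p < -1} \<inter> D = {} \<or> {p. fst p > -1} \<inter> D = {}"
    proof (rule connectedD)
      show "connected D" using D by blast
      show "open {p :: real \<times> real. fst p < -1}" "open {p :: real \<times> real. fst p > -1}"
        by (intro open_Collect_less continuous_intros)+
      show "D \<subseteq> {p. fst p < -1} \<union> {p. fst p > -1}"
      proof
        fix p assume "p \<in> D"
        then have "ham (fst p) (snd p) = h" using D by auto
        then have "fst p \<noteq> -1" using ham_ge_at_left[of "snd p"] h by auto
        then show "p \<in> {p. fst p < -1} \<union> {p. fst p > -1}" by auto
      qed
    qed auto
    moreover obtain q where "q \<in> ?K" using ne by blast
    then have "q \<in> {p. fst p > -1} \<inter> D" using D by auto
    ultimately have left: "{p. fst p < -1} \<inter> D = {}" by blast
    have "D \<subseteq> ?K"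
    proof
      fix p assume p: "p \<in> D"
      then have "ham (fst p) (snd p) = h" using D by auto
      moreover have "\<not> fst p < -1" using p left by blast
      moreover have "fst p \<noteq> -1" using calculation(1) ham_ge_at_left[of "snd p"] h by auto
      ultimately show "p \<in> ?K" by auto
    qed
    then show "D = ?K" using D by blast
  qed auto
qed

lemma bounded_oval_interior: "bounded (oval_interior h)"
proof (rule bounded_subset[OF bounded_cbox[of "(-1, -1)" "(1, 1)"]], rule subsetI)
  fix p assume "p \<in> oval_interior h"
  then show "p \<in> cbox (-1, -1) (1, 1)"
    using ham_bound[of "fst p" "snd p"] by (cases p) (auto simp: oval_interior_def cbox_Pair_eq abs_less_iff)
qed

lemma open_oval_interior: "open (oval_interior h)"
proof -
  have "oval_interior h = {p. -1 < fst p} \<inter> {p. ham (fst p) (snd p) < h}"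
    by (auto simp: oval_interior_def)
  then show ?thesis
    by (auto intro!: open_Int open_Collect_less continuous_intros continuous_on_ham)
qed

lemma origin_in_oval_interior: "(0, 0) \<in> oval_interior h"
  using h by (simp add: oval_interior_def ham_def)

lemma inside_oval_eq: "inside {(x, y). -1 < x \<and> ham x y = h} = oval_interior h"
proof (intro subset_antisym subsetI)
  let ?K = "{(x, y). -1 < x \<and> ham x y = h}"
  have disj: "oval_interior h \<subseteq> - ?K" by (auto simp: oval_interior_def)
  fix p assume p: "p \<in> oval_interior h"
  let ?C = "connected_component_set (- ?K) p"
  have "oval_interior h \<inter> ?C = {} \<or> {q. fst q < -1 \<or> ham (fst q) (snd q) > h} \<inter> ?C = {}"
  proof (rule connectedD)
    show "connected ?C" by (rule connected_connected_component)
    show "open (oval_interior h)" by (rule open_oval_interior)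
    show "open {q :: real \<times> real. fst q < -1 \<or> ham (fst q) (snd q) > h}"
      by (intro open_Collect_disj open_Collect_less continuous_intros continuous_on_ham)
    show "oval_interior h \<inter> {q. fst q < -1 \<or> ham (fst q) (snd q) > h} \<inter> ?C = {}"
      by (auto simp: oval_interior_def)
    show "?C \<subseteq> oval_interior h \<union> {q. fst q < -1 \<or> ham (fst q) (snd q) > h}"
    proof
      fix q assume "q \<in> ?C"
      then have "q \<notin> ?K" using connected_component_subset by blast
      moreover have "fst q = -1 \<Longrightarrow> ham (fst q) (snd q) > h"
        using ham_ge_at_left[of "snd q"] h by auto
      ultimately show "q \<in> oval_interior h \<union> {q. fst q < -1 \<or> ham (fst q) (snd q) > h}"
        using linorder_less_linear[of "fst q" "-1"] by (cases q) (auto simp: oval_interior_def)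
    qed
  qed
  moreover have "p \<in> ?C" using p disj by auto
  ultimately have outer: "{q. fst q < -1 \<or> ham (fst q) (snd q) > h} \<inter> ?C = {}" using p by blast
  have "?C \<subseteq> oval_interior h"
  proof
    fix q assume q: "q \<in> ?C"
    then have "q \<notin> ?K" using connected_component_subset by blast
    moreover have "fst q = -1 \<Longrightarrow> ham (fst q) (snd q) > h"
      using ham_ge_at_left[of "snd q"] h by auto
    moreover have "\<not> (fst q < -1 \<or> ham (fst q) (snd q) > h)"
      using q outer by blast
    ultimately show "q \<in> oval_interior h"
      using linorder_less_linear[of "fst q" "-1"] by (cases q) (auto simp: oval_interior_def)
  qed
  then show "p \<in> inside ?K"
    using p disj bounded_subset[OF bounded_oval_interior] by (auto simp: inside_def)
next
  let ?K = "{(x, y). -1 < x \<and> ham x y = h}"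
  fix p assume p: "p \<in> inside ?K"
  obtain a b where ab: "p = (a, b)" by (cases p)
  show "p \<in> oval_interior h"
  proof (rule ccontr)
    assume "p \<notin> oval_interior h"
    moreover have "p \<notin> ?K" using p by (simp add: inside_def)
    ultimately consider "a \<le> -1" | "-1 < a" "ham a b > h" using ab by (fastforce simp: oval_interior_def)
    then show False
    proof cases
      case 1
      then show False using inside_meets_ray[OF p, of "(-1, 0)"] ab by (auto simp: zero_prod_def)
    next
      case 2
      define v :: real where "v = (if b \<ge> 0 then 1 else -1)"
      have "(0 :: real, v) \<noteq> 0" by (simp add: v_def zero_prod_def)
      then obtain t where t: "t \<ge> 0" "ham a (b + t * v) = h"
        using inside_meets_ray[OF p, of "(0, v)"] ab by auto
      have "\<bar>b\<bar> \<le> \<bar>b + t * v\<bar>" using t by (auto simp: v_def)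
      then have "b\<^sup>2 \<le> (b + t * v)\<^sup>2" by (simp only: abs_le_square_iff)
      then show False using 2 t by (simp add: ham_def)
    qed
  qed
qed

lemma oval_eq: "oval h = {(x, y). -1 < x \<and> ham x y = h}"
  unfolding oval_def
proof (rule the_equality)
  let ?K = "{(x, y). -1 < x \<and> ham x y = h}" and ?S = "{(x, y). ham x y = h}"
  show "?K \<in> components ?S \<and> (0, 0) \<in> inside ?K"
    using level_right_component inside_oval_eq origin_in_oval_interior by simp
  fix C assume C: "C \<in> components ?S \<and> (0, 0) \<in> inside C"
  show "C = ?K"
  proof (rule ccontr)
    assume "C \<noteq> ?K"
    then have "C \<inter> ?K = {}" using C level_right_component components_nonoverlap by blast
    moreover obtain t where "t \<ge> 0" "(t, 0) \<in> C"
      using inside_meets_ray[of "(0, 0)" C "(1, 0)"] C by (auto simp: zero_prod_def)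
    moreover have "C \<subseteq> ?S" using C in_components_subset by blast
    ultimately show False by fastforce
  qed
qed

end

subsection \<open>The enclosed area\<close>

lemma has_integral_even:
  fixes f :: "real \<Rightarrow> real"
  assumes "(f has_integral I) {-a..0}" "a \<ge> 0" "\<And>x. f (- x) = f x"
  shows "(f has_integral I + I) {-a..a}"
proof (rule has_integral_combine[OF _ _ assms(1)])
  have "((\<lambda>x. f (- x)) has_integral I) {-a..-0}" using assms by simp
  then show "(f has_integral I) {0..a}" by (simp only: has_integral_reflect_real)
qed (use assms in auto)

lemma ham_area_eq:
  assumes h: "0 < h" "h < 1/6"
  shows "ham_area h = xflux 0 h"
proof -
  define r where "r = sqrt (2 * h)"
  have r: "r > 0" "r\<^sup>2 = 2 * h" "\<bar>r\<bar> < sqrt (1/3)" using h by (auto simp: r_def)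
  define a b where "a = xcoord (- r)" and "b = xcoord r"
  have ab: "-1 < a" "wcoord a = - r" "-1 < b" "wcoord b = r"
    using r xcoord_bounds[of r] xcoord_bounds[of "- r"] wcoord_xcoord[of r] wcoord_xcoord[of "- r"]
    by (auto simp: a_def b_def)
  have "a \<le> b"
    using wcoord_strict_mono[of b a] ab r by fastforce
  define f where "f x = 2 * sqrt (2 * h - (wcoord x)\<^sup>2)" for x
  have contf: "continuous_on S f" for S
    unfolding f_def by (intro continuous_intros wcoord_continuous_on)
  have fpos: "f x \<ge> 0" if "x \<in> {a..b}" for x
  proof -
    have "- r \<le> wcoord x" "wcoord x \<le> r"
      using that ab wcoord_strict_mono[of x b] wcoord_strict_mono[of a x] by (auto simp: le_less)
    then have "(wcoord x)\<^sup>2 \<le> r\<^sup>2" by (simp add: abs_le_square_iff[symmetric])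
    then show ?thesis using r by (simp add: f_def)
  qed
  have slice: "emeasure lborel (Pair x -` oval_interior h) = ennreal (indicator {a..b} x * f x)" for x
  proof (cases "x \<in> {a..b}")
    case True
    then have x: "-1 < x" "- r \<le> wcoord x" "wcoord x \<le> r"
      using ab wcoord_strict_mono[of x b] wcoord_strict_mono[of a x] by (auto simp: le_less)
    then have le: "(wcoord x)\<^sup>2 \<le> r\<^sup>2" by (simp add: abs_le_square_iff[symmetric])
    have "Pair x -` oval_interior h = {- sqrt (2 * h - (wcoord x)\<^sup>2)<..<sqrt (2 * h - (wcoord x)\<^sup>2)}"
    proof (intro set_eqI)
      fix y
      have "y \<in> Pair x -` oval_interior h \<longleftrightarrow> y\<^sup>2 < 2 * h - (wcoord x)\<^sup>2"
        using x ham_eq_wcoord[of x y] by (auto simp: oval_interior_def)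
      also have "\<dots> \<longleftrightarrow> \<bar>y\<bar> < sqrt (2 * h - (wcoord x)\<^sup>2)"
        using real_sqrt_less_iff[of "y\<^sup>2" "2 * h - (wcoord x)\<^sup>2"] by (simp del: real_sqrt_less_iff)
      finally show "y \<in> Pair x -` oval_interior h \<longleftrightarrow>
          y \<in> {- sqrt (2 * h - (wcoord x)\<^sup>2)<..<sqrt (2 * h - (wcoord x)\<^sup>2)}" by auto
    qed
    then show ?thesis using True le r by (simp add: f_def)
  next
    case False
    have "ham x y \<ge> h" if "-1 < x" for y
    proof -
      have "\<bar>r\<bar> \<le> \<bar>wcoord x\<bar>"
      proof (cases "x < a")
        case True
        then show ?thesis using wcoord_strict_mono[of x a] that ab r by auto
      next
        case False
        then show ?thesis using wcoord_strict_mono[of b x] \<open>x \<notin> {a..b}\<close> ab r by auto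
      qed
      then have "r\<^sup>2 \<le> (wcoord x)\<^sup>2" by (simp only: abs_le_square_iff)
      then show ?thesis using ham_eq_wcoord[of x y, OF less_imp_le[OF that]] r(2) zero_le_power2[of y] by argo
    qed
    then have "Pair x -` oval_interior h = {}" by (auto simp: oval_interior_def not_less)
    then show ?thesis using False by simp
  qed
  have "emeasure lborel (oval_interior h) = (\<integral>\<^sup>+ x. emeasure lborel (Pair x -` oval_interior h) \<partial>lborel)"
    using lborel.emeasure_pair_measure_alt[of "oval_interior h" "lborel :: real measure"]
      borel_open[OF open_oval_interior[OF h]] by (simp add: lborel_prod flip: borel_prod)
  also have "\<dots> = (\<integral>\<^sup>+ x. ennreal (indicator {a..b} x * f x) \<partial>lborel)"
    by (simp only: slice)
  also have "\<dots> = ennreal (integral {a..b} f)"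
  proof (rule nn_integral_has_integral_lebesgue[OF fpos])
    show "(f has_integral integral {a..b} f) {a..b}"
      by (intro integrable_integral integrable_continuous_interval contf)
  qed
  finally have em: "emeasure lborel (oval_interior h) = ennreal (integral {a..b} f)" .
  let ?g = "\<lambda>\<theta>. xcoord (sqrt (2 * h) * cos \<theta>)"
  define k where "k \<theta> = 2 * h * (sin \<theta>)\<^sup>2 * (xcoord (sqrt (2 * h) * cos \<theta>) ^ 0 * weight (sqrt (2 * h) * cos \<theta>))" for \<theta>
  have "((\<lambda>\<theta>. (- (weight (sqrt (2 * h) * cos \<theta>) * (sqrt (2 * h) * sin \<theta>))) *\<^sub>R f (?g \<theta>))
      has_integral integral {?g (-pi)..?g 0} f) {-pi..0}"
  proof (rule has_integral_substitution[where c = "-1" and d = 1])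
    show "?g ` {- pi..0} \<subseteq> {- 1..1}"
      using xcoord_bounds[OF level_cos_bound[OF h]] by (force intro: less_imp_le)
    show "?g (-pi) \<le> ?g 0" using \<open>a \<le> b\<close> by (simp add: a_def b_def r_def)
  qed (auto intro: contf has_field_derivative_at_within xcoord_level_has_derivative[OF h])
  then have "((\<lambda>\<theta>. (- (weight (sqrt (2 * h) * cos \<theta>) * (sqrt (2 * h) * sin \<theta>))) *\<^sub>R f (?g \<theta>))
      has_integral integral {a..b} f) {-pi..0}"
    by (simp add: a_def b_def r_def)
  moreover have "(- (weight (sqrt (2 * h) * cos \<theta>) * (sqrt (2 * h) * sin \<theta>))) *\<^sub>R f (?g \<theta>) = k \<theta> + k \<theta>"
    if "\<theta> \<in> {-pi..0}" for \<theta>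
  proof -
    have s: "sin \<theta> \<le> 0" using that sin_ge_zero[of "- \<theta>"] by simp
    have "2 * h - (wcoord (?g \<theta>))\<^sup>2 = 2 * h * (1 - (cos \<theta>)\<^sup>2)"
      unfolding wcoord_xcoord[OF level_cos_bound[OF h]]
      using h by (simp add: power_mult_distrib algebra_simps)
    also have "\<dots> = 2 * h * (sin \<theta>)\<^sup>2" by (simp add: sin_squared_eq)
    finally have "f (?g \<theta>) = 2 * (sqrt (2 * h) * \<bar>sin \<theta>\<bar>)"
      by (simp add: f_def real_sqrt_mult)
    then have "(- (weight (sqrt (2 * h) * cos \<theta>) * (sqrt (2 * h) * sin \<theta>))) *\<^sub>R f (?g \<theta>)
       = 2 * ((sqrt (2 * h))\<^sup>2 * (sin \<theta>)\<^sup>2 * weight (sqrt (2 * h) * cos \<theta>))"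
      using s by (simp add: power2_eq_square)
    also have "(sqrt (2 * h))\<^sup>2 = 2 * h" using h by simp
    finally show ?thesis by (simp add: k_def)
  qed
  ultimately have "((\<lambda>\<theta>. k \<theta> + k \<theta>) has_integral integral {a..b} f) {-pi..0}"
    by (rule has_integral_eq[rotated])
  then have "((\<lambda>\<theta>. k \<theta> + k \<theta>) has_integral integral {a..b} f + integral {a..b} f) {-pi..pi}"
    by (rule has_integral_even) (auto simp: k_def)
  moreover have "((\<lambda>\<theta>. k \<theta> + k \<theta>) has_integral xflux 0 h + xflux 0 h) {-pi..pi}"
    unfolding k_def by (intro has_integral_add xflux_has_integral[OF h])
  ultimately have "integral {a..b} f + integral {a..b} f = xflux 0 h + xflux 0 h"
    by (rule has_integral_unique)
  then have flux: "xflux 0 h = integral {a..b} f" by simp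
  have "integral {a..b} f \<ge> 0"
    by (intro integral_nonneg integrable_continuous_interval contf fpos)
  have "ham_area h = measure lborel (oval_interior h)"
    using borel_open[OF open_oval_interior[OF h]]
    by (simp add: ham_area_def oval_eq[OF h] inside_oval_eq[OF h] measure_completion)
  then show ?thesis
    using em flux \<open>integral {a..b} f \<ge> 0\<close> by (simp add: measure_def)
qed

lemma ham_area_pos:
  assumes h: "0 < h" "h < 1/6"
  shows "ham_area h > 0"
proof -
  have lm: "oval_interior h \<in> lmeasurable"
    by (rule lmeasurable_open[OF bounded_oval_interior[OF h] open_oval_interior[OF h]])
  have "\<not> negligible (oval_interior h)"
    using open_not_negligible[OF open_oval_interior[OF h]] origin_in_oval_interior[OF h] by blast
  then have "measure lebesgue (oval_interior h) \<noteq> 0"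
    using lm by (simp add: negligible_iff_measure0)
  then show ?thesis
    by (simp add: ham_area_def oval_eq[OF h] inside_oval_eq[OF h] zero_less_measure_iff)
qed

subsection \<open>Periodic solutions\<close>

lemma periodic_antiderivative:
  fixes f :: "real \<Rightarrow> real"
  assumes cont: "continuous_on UNIV f" and per: "\<And>x. f (x + 2 * pi) = f x"
  obtains F where "\<And>x. (F has_real_derivative f x) (at x)" "F 0 = 0"
    "\<And>x. F (x + 2 * pi) = F x + integral {-pi..pi} f"
proof -
  have "\<exists>G. \<forall>x. (-\<infinity> :: ereal) < ereal x \<longrightarrow> ereal x < \<infinity> \<longrightarrow> (G has_vector_derivative f x) (at x)"
    using cont by (intro einterval_antiderivative) (auto simp: continuous_on_eq_continuous_at)
  then obtain G where G: "\<And>x. (G has_real_derivative f x) (at x)"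
    by (auto simp: has_real_derivative_iff_has_vector_derivative)
  define F where "F x = G x - G 0" for x
  have F: "(F has_real_derivative f x) (at x)" for x
    unfolding F_def[abs_def] using G by (auto intro!: derivative_eq_intros)
  have "((\<lambda>x. F (x + 2 * pi) - F x) has_real_derivative 0) (at x)" for x
  proof -
    have "((\<lambda>x. F (x + 2 * pi)) has_real_derivative f x) (at x)"
      using F[of "x + 2 * pi"] by (simp add: DERIV_shift per)
    from DERIV_diff[OF this F] show ?thesis by simp
  qed
  then have const: "F (x + 2 * pi) - F x = F (- pi + 2 * pi) - F (- pi)" for x
    using DERIV_isconst_all[of "\<lambda>x. F (x + 2 * pi) - F x" x "- pi"] by blast
  have "(f has_integral F pi - F (- pi)) {-pi..pi}"
    using F by (intro fundamental_theorem_of_calculus)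
      (auto simp: has_real_derivative_iff_has_vector_derivative has_vector_derivative_at_within)
  then have "integral {-pi..pi} f = F pi - F (- pi)" by (rule integral_unique)
  then have "F (x + 2 * pi) = F x + integral {-pi..pi} f" for x
    using const[of x] by simp
  then show ?thesis by (rule that[OF F, rotated]) (simp add: F_def)
qed

lemma surj_of_derivative_bounded_below:
  fixes f :: "real \<Rightarrow> real"
  assumes f: "\<And>x. (f has_real_derivative f' x) (at x)" and m: "m > 0" "\<And>x. f' x \<ge> m"
  shows "surj f"
proof (rule surjI)
  define g where "g x = f x - m * x" for x
  have mono: "g x \<le> g y" if "x \<le> y" for x y
  proof (rule DERIV_nonneg_imp_nondecreasing[OF that])
    fix z
    have "(g has_real_derivative f' z - m) (at z)"
      unfolding g_def[abs_def] using f by (auto intro!: derivative_eq_intros)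
    then show "\<exists>D. (g has_real_derivative D) (at z) \<and> 0 \<le> D" using m by auto
  qed
  fix t
  define R where "R = \<bar>t - f 0\<bar> / m"
  have R: "R \<ge> 0" "m * R = \<bar>t - f 0\<bar>" using m by (auto simp: R_def)
  have "f (- R) \<le> t" "t \<le> f R" using mono[of "- R" 0] mono[of 0 R] R by (auto simp: g_def)
  then have "\<exists>x\<ge>-R. x \<le> R \<and> f x = t"
    using R f by (intro IVT') (auto intro: DERIV_continuous_on has_field_derivative_at_within)
  then show "f (SOME x. f x = t) = t" using someI_ex[of "\<lambda>x. f x = t"] by blast
qed

lemma ham_field_proj: "ham_field p = (- snd p, fst p + (fst p)\<^sup>2)"
  by (cases p) (simp add: ham_field_eq)

lemma ham_solution_unique:
  assumes u: "ham_solution u" and v: "ham_solution v" and eq: "u 0 = v 0"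
    and bu: "\<And>t. \<bar>fst (u t)\<bar> \<le> 1" and bv: "\<And>t. \<bar>fst (v t)\<bar> \<le> 1"
  shows "u t = v t"
proof -
  have comp: "((\<lambda>s. fst (w s)) has_real_derivative - snd (w s)) (at s)"
    "((\<lambda>s. snd (w s)) has_real_derivative fst (w s) + (fst (w s))\<^sup>2) (at s)"
    if "ham_solution w" for w s
  proof -
    have "(w has_vector_derivative (- snd (w s), fst (w s) + (fst (w s))\<^sup>2)) (at s)"
      using that by (simp add: ham_solution_def ham_field_proj)
    then show "((\<lambda>s. fst (w s)) has_real_derivative - snd (w s)) (at s)"
      "((\<lambda>s. snd (w s)) has_real_derivative fst (w s) + (fst (w s))\<^sup>2) (at s)"
      using bounded_linear.has_vector_derivative[OF bounded_linear_fst, of w _ "at s"]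
        bounded_linear.has_vector_derivative[OF bounded_linear_snd, of w _ "at s"]
      by (fastforce simp: has_real_derivative_iff_has_vector_derivative)+
  qed
  define a where "a s = fst (u s) - fst (v s)" for s
  define b where "b s = snd (u s) - snd (v s)" for s
  define c where "c s = fst (u s) + fst (v s)" for s
  define N where "N s = (a s)\<^sup>2 + (b s)\<^sup>2" for s
  have da: "(a has_real_derivative - b s) (at s)" for s
    unfolding a_def[abs_def] b_def using DERIV_diff[OF comp(1)[OF u] comp(1)[OF v]] by simp
  have db: "(b has_real_derivative a s + a s * c s) (at s)" for s
    unfolding a_def b_def[abs_def] c_def using DERIV_diff[OF comp(2)[OF u] comp(2)[OF v]]
    by (simp add: algebra_simps power2_eq_square)
  have dN: "(N has_real_derivative 2 * a s * b s * c s) (at s)" for s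
    unfolding N_def[abs_def] by (auto intro!: derivative_eq_intros da db simp: algebra_simps)
  have bound: "\<bar>2 * a s * b s * c s\<bar> \<le> 2 * N s" for s
  proof -
    have "\<bar>c s\<bar> \<le> 2" using bu[of s] bv[of s] by (simp add: c_def)
    then have "\<bar>2 * a s * b s\<bar> * \<bar>c s\<bar> \<le> \<bar>2 * a s * b s\<bar> * 2" by (intro mult_left_mono) auto
    also have "\<bar>2 * a s * b s\<bar> \<le> N s"
      using sum_squares_bound[of "\<bar>a s\<bar>" "\<bar>b s\<bar>"] by (simp add: N_def abs_mult)
    finally show ?thesis by (simp add: abs_mult)
  qed
  have N0: "N 0 = 0" using eq by (simp add: N_def a_def b_def)
  have "N t \<le> 0"
  proof (cases "t \<ge> 0")
    case True
    have "N t * exp (- 2 * t) \<le> N 0 * exp (- 2 * 0)"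
    proof (rule DERIV_nonpos_imp_nonincreasing[OF True])
      fix s
      have "((\<lambda>s. N s * exp (- 2 * s)) has_real_derivative (2 * a s * b s * c s - 2 * N s) * exp (- 2 * s)) (at s)"
        by (auto intro!: derivative_eq_intros dN simp: algebra_simps)
      moreover have "(2 * a s * b s * c s - 2 * N s) * exp (- 2 * s) \<le> 0"
        using bound[of s] by (intro mult_nonpos_nonneg) auto
      ultimately show "\<exists>y. ((\<lambda>s. N s * exp (- 2 * s)) has_real_derivative y) (at s) \<and> y \<le> 0" by blast
    qed
    then show ?thesis using N0 by (simp add: mult_le_0_iff)
  next
    case False
    then have "t \<le> 0" by simp
    then have "N t * exp (2 * t) \<le> N 0 * exp (2 * 0)"
    proof (rule DERIV_nonneg_imp_nondecreasing)
      fix s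
      have "((\<lambda>s. N s * exp (2 * s)) has_real_derivative (2 * a s * b s * c s + 2 * N s) * exp (2 * s)) (at s)"
        by (auto intro!: derivative_eq_intros dN simp: algebra_simps)
      moreover have "(2 * a s * b s * c s + 2 * N s) * exp (2 * s) \<ge> 0"
        using bound[of s] by (intro mult_nonneg_nonneg) auto
      ultimately show "\<exists>y. ((\<lambda>s. N s * exp (2 * s)) has_real_derivative y) (at s) \<and> 0 \<le> y" by blast
    qed
    then show ?thesis using N0 by (simp add: mult_le_0_iff)
  qed
  then have "a t = 0 \<and> b t = 0"
    by (simp add: N_def sum_power2_le_zero_iff)
  then show ?thesis by (simp add: a_def b_def prod_eq_iff)
qed

lemma ham_solution_shift:
  assumes "ham_solution u"
  shows "ham_solution (\<lambda>t. u (t + c))"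
  unfolding ham_solution_def
proof
  fix t
  have "(u has_vector_derivative ham_field (u (t + c))) (at (t + c))"
    using assms by (simp add: ham_solution_def)
  moreover have "((\<lambda>t. t + c) has_vector_derivative 1) (at t)"
    by (auto intro!: derivative_eq_intros)
  ultimately show "((\<lambda>t. u (t + c)) has_vector_derivative ham_field (u (t + c))) (at t)"
    using vector_diff_chain_at[of "\<lambda>t. t + c" 1 t u] by (simp add: o_def)
qed

text \<open>\<open>\<Theta> t\<close> is the angle \<open>\<theta>\<close> at time \<open>t\<close> along the flow, normalized to vanish at time zero.\<close>

definition oval_clock :: "real \<Rightarrow> (real \<Rightarrow> real) \<Rightarrow> bool" where
  "oval_clock h \<Theta> \<longleftrightarrow>
     (\<forall>t. (\<Theta> has_real_derivative inverse (weight (sqrt (2 * h) * cos (\<Theta> t)))) (at t)) \<and>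
     strict_mono \<Theta> \<and> surj \<Theta> \<and> \<Theta> 0 = 0 \<and> (\<forall>t. \<Theta> (t + xmoment 0 h) = \<Theta> t + 2 * pi)"

context
  fixes h :: real
  assumes h: "0 < h" "h < 1/6"
begin

lemma oval_point_periodic: "oval_point h (\<theta> + 2 * pi) = oval_point h \<theta>"
  by (simp add: oval_point_def)

lemma oval_clock_exists: "\<exists>\<Theta>. oval_clock h \<Theta>"
proof -
  let ?q = "\<lambda>\<theta>. weight (sqrt (2 * h) * cos \<theta>)"
  have cont: "continuous_on UNIV ?q"
    by (rule continuous_on_level_cos[OF continuous_on_weight h])
  obtain \<tau> where \<tau>: "\<And>\<theta>. (\<tau> has_real_derivative ?q \<theta>) (at \<theta>)" "\<tau> 0 = 0"
    "\<And>\<theta>. \<tau> (\<theta> + 2 * pi) = \<tau> \<theta> + integral {-pi..pi} ?q"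
    by (rule periodic_antiderivative[OF cont]) auto
  have per: "\<tau> (\<theta> + 2 * pi) = \<tau> \<theta> + xmoment 0 h" for \<theta>
    using \<tau>(3) by (simp add: xmoment_integral)
  have qpos: "?q \<theta> > 0" for \<theta> by (rule weight_pos[OF level_cos_bound[OF h]])
  have mono: "\<tau> x < \<tau> y" if "x < y" for x y
    using \<tau>(1) qpos by (intro DERIV_pos_imp_increasing[OF that]) blast
  then have sm: "strict_mono \<tau>" by (simp add: strict_mono_def)
  have surj: "surj \<tau>"
    by (rule surj_of_derivative_bounded_below[OF \<tau>(1) _ weight_lower_bound[OF level_cos_bound[OF h]]])
      simp
  define \<Theta> where "\<Theta> = inv \<tau>"
  have inv1: "\<Theta> (\<tau> \<theta>) = \<theta>" for \<theta>
    by (simp add: \<Theta>_def inv_f_f strict_mono_imp_inj_on[OF sm])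
  have inv2: "\<tau> (\<Theta> t) = t" for t by (simp add: \<Theta>_def surj_f_inv_f[OF surj])
  have "continuous_on UNIV \<tau>"
    by (rule DERIV_continuous_on[OF \<tau>(1)])
  then have "(\<Theta> has_real_derivative inverse (?q (\<Theta> t))) (at (\<tau> (\<Theta> t)))" for t
    using qpos[of "\<Theta> t"] by (intro has_real_derivative_inverse[OF \<tau>(1), where S = UNIV] inv1) auto
  then have "(\<Theta> has_real_derivative inverse (?q (\<Theta> t))) (at t)" for t
    by (simp add: inv2)
  moreover have "strict_mono \<Theta>"
    unfolding strict_mono_def using strict_mono_less[OF sm] inv2 by metis
  moreover have "surj \<Theta>" using inv1 by (rule surjI)
  moreover have "\<Theta> 0 = 0" using inv1[of 0] \<tau>(2) by simp
  moreover have "\<Theta> (t + xmoment 0 h) = \<Theta> t + 2 * pi" for t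
    using inv1[of "\<Theta> t + 2 * pi"] per[of "\<Theta> t"] inv2 by simp
  ultimately show ?thesis unfolding oval_clock_def by blast
qed

lemma oval_solution_oval_point:
  assumes "oval_clock h \<Theta>"
  shows "oval_solution h (\<lambda>t. oval_point h (\<Theta> t))"
  unfolding oval_solution_def
proof
  have "range (\<lambda>t. oval_point h (\<Theta> t)) = oval_point h ` range \<Theta>" by (simp add: image_image)
  also have "range \<Theta> = UNIV" using assms by (simp add: oval_clock_def)
  finally show "range (\<lambda>t. oval_point h (\<Theta> t)) = oval h"
    using range_oval_point[OF h] oval_eq[OF h] by simp
  show "ham_solution (\<lambda>t. oval_point h (\<Theta> t))"
    unfolding ham_solution_def
  proof
    fix t
    define q where "q = weight (sqrt (2 * h) * cos (\<Theta> t))"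
    have q: "q > 0" unfolding q_def by (rule weight_pos[OF level_cos_bound[OF h]])
    have d: "(\<Theta> has_real_derivative inverse q) (at t)" using assms by (simp add: oval_clock_def q_def)
    have "((\<lambda>t. xcoord (sqrt (2 * h) * cos (\<Theta> t))) has_real_derivative
        - (q * (sqrt (2 * h) * sin (\<Theta> t))) * inverse q) (at t)"
      using DERIV_chain2[OF xcoord_level_has_derivative[OF h] d] by (simp add: q_def)
    then have x: "((\<lambda>t. xcoord (sqrt (2 * h) * cos (\<Theta> t))) has_vector_derivative
        - (sqrt (2 * h) * sin (\<Theta> t))) (at t)"
      using q by (simp add: has_real_derivative_iff_has_vector_derivative field_simps)
    have "sqrt (2 * h) * cos (\<Theta> t) = q * (xcoord (sqrt (2 * h) * cos (\<Theta> t)) + (xcoord (sqrt (2 * h) * cos (\<Theta> t)))\<^sup>2)"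
      unfolding q_def using weight_ode[OF level_cos_bound[OF h]] by simp
    then have "sqrt (2 * h) * cos (\<Theta> t) * inverse q
       = xcoord (sqrt (2 * h) * cos (\<Theta> t)) + (xcoord (sqrt (2 * h) * cos (\<Theta> t)))\<^sup>2"
      using q by (simp add: field_simps)
    moreover have "((\<lambda>t. sqrt (2 * h) * sin (\<Theta> t)) has_real_derivative
       sqrt (2 * h) * cos (\<Theta> t) * inverse q) (at t)"
      using d by (auto intro!: derivative_eq_intros)
    ultimately have "((\<lambda>t. sqrt (2 * h) * sin (\<Theta> t)) has_vector_derivative
       xcoord (sqrt (2 * h) * cos (\<Theta> t)) + (xcoord (sqrt (2 * h) * cos (\<Theta> t)))\<^sup>2) (at t)"
      by (simp add: has_real_derivative_iff_has_vector_derivative)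
    with x show "((\<lambda>t. oval_point h (\<Theta> t)) has_vector_derivative ham_field (oval_point h (\<Theta> t))) (at t)"
      unfolding oval_point_def ham_field_eq by (rule has_vector_derivative_Pair)
  qed
qed

lemma oval_solution_eq_shift:
  assumes clock: "oval_clock h \<Theta>" and v: "oval_solution h v"
  obtains c where "\<And>t. v t = oval_point h (\<Theta> (t + c))"
proof -
  let ?u = "\<lambda>t. oval_point h (\<Theta> t)"
  have u: "oval_solution h ?u" by (rule oval_solution_oval_point[OF clock])
  have "v 0 \<in> range ?u" using u v by (auto simp: oval_solution_def)
  then obtain c where c: "v 0 = ?u c" by blast
  have bd: "\<bar>fst p\<bar> \<le> 1" if "p \<in> oval h" for p
    using that ham_bound[OF h, of "fst p" "snd p"] by (auto simp: oval_eq[OF h])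
  have "v t = ?u (t + c)" for t
  proof (rule ham_solution_unique[of v "\<lambda>t. ?u (t + c)" t])
    show "ham_solution v" using v by (simp add: oval_solution_def)
    show "ham_solution (\<lambda>t. ?u (t + c))"
      using u by (intro ham_solution_shift) (simp add: oval_solution_def)
    show "v 0 = ?u (0 + c)" using c by simp
    show "\<bar>fst (v t)\<bar> \<le> 1" for t using v by (intro bd) (auto simp: oval_solution_def)
    show "\<bar>fst (?u (t + c))\<bar> \<le> 1" for t using u by (intro bd) (auto simp: oval_solution_def)
  qed
  then show ?thesis by (rule that)
qed

lemma ham_period_eq: "ham_period h = xmoment 0 h"
  unfolding ham_period_def
proof (rule Least_equality)
  obtain \<Theta> where clock: "oval_clock h \<Theta>" using oval_clock_exists by blast
  then have sm: "strict_mono \<Theta>" and zero: "\<Theta> 0 = 0"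
    and per: "\<And>t. \<Theta> (t + xmoment 0 h) = \<Theta> t + 2 * pi" by (auto simp: oval_clock_def)
  have "\<Theta> 0 < \<Theta> (xmoment 0 h)" using per[of 0] zero by simp
  then have "xmoment 0 h > 0" using strict_mono_less[OF sm] by blast
  moreover have "oval_point h (\<Theta> (t + xmoment 0 h)) = oval_point h (\<Theta> t)" for t
    by (simp add: per oval_point_periodic)
  ultimately show "xmoment 0 h > 0 \<and> (\<exists>u. oval_solution h u \<and> (\<forall>t. u (t + xmoment 0 h) = u t))"
    using oval_solution_oval_point[OF clock] by blast
  fix \<tau> assume "\<tau> > 0 \<and> (\<exists>u. oval_solution h u \<and> (\<forall>t. u (t + \<tau>) = u t))"
  then obtain v where \<tau>: "\<tau> > 0" and v: "oval_solution h v" "\<And>t. v (t + \<tau>) = v t" by blast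
  obtain c where c: "\<And>t. v t = oval_point h (\<Theta> (t + c))"
    using oval_solution_eq_shift[OF clock v(1)] by blast
  have "oval_point h (\<Theta> \<tau>) = oval_point h (\<Theta> 0)" using v(2)[of "- c"] by (simp add: c)
  then have "xcoord (sqrt (2 * h) * cos (\<Theta> \<tau>)) = xcoord (sqrt (2 * h) * cos 0)"
    by (simp add: oval_point_def zero)
  then have "sqrt (2 * h) * cos (\<Theta> \<tau>) = sqrt (2 * h) * cos 0"
    using wcoord_xcoord[OF level_cos_bound[OF h]] by metis
  then have "cos (\<Theta> \<tau>) = 1" using h by simp
  then obtain n :: int where n: "\<Theta> \<tau> = real_of_int n * 2 * pi" using cos_one_2pi_int by blast
  have "\<Theta> \<tau> > 0" using strict_monoD[OF sm \<tau>] zero by simp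
  then have "n > 0" using n by (simp add: zero_less_mult_iff)
  then have "1 * (2 * pi) \<le> real_of_int n * (2 * pi)" by (intro mult_right_mono) auto
  then have "\<Theta> (xmoment 0 h) \<le> \<Theta> \<tau>" using per[of 0] zero n by simp
  then show "xmoment 0 h \<le> \<tau>" using strict_mono_less_eq[OF sm] by blast
qed

lemma ham_integral_eq: "ham_integral j h = - xflux j h"
proof -
  obtain \<Theta> where clock: "oval_clock h \<Theta>" using oval_clock_exists by blast
  define v where "v = (SOME u. oval_solution h u)"
  have v: "oval_solution h v"
    unfolding v_def using oval_solution_oval_point[OF clock] by (rule someI[of "oval_solution h"])
  obtain c where c: "\<And>t. v t = oval_point h (\<Theta> (t + c))"
    using oval_solution_eq_shift[OF clock v] by blast
  let ?k = "\<lambda>\<theta>. 2 * h * (sin \<theta>)\<^sup>2 * (xcoord (sqrt (2 * h) * cos \<theta>) ^ j * weight (sqrt (2 * h) * cos \<theta>))"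
  have cont: "continuous_on UNIV ?k"
    by (intro continuous_intros continuous_on_level_cos continuous_on_xcoord continuous_on_weight h)
  obtain F where F: "\<And>\<theta>. (F has_real_derivative ?k \<theta>) (at \<theta>)"
    "\<And>\<theta>. F (\<theta> + 2 * pi) = F \<theta> + integral {-pi..pi} ?k"
    by (rule periodic_antiderivative[OF cont]) auto
  have integrand: "((\<lambda>t. - F (\<Theta> (t + c))) has_real_derivative
      fst (v t) ^ j * snd (v t) * deriv (\<lambda>s. fst (v s)) t) (at t)" for t
  proof -
    define \<theta> where "\<theta> = \<Theta> (t + c)"
    have q: "weight (sqrt (2 * h) * cos \<theta>) > 0" by (rule weight_pos[OF level_cos_bound[OF h]])
    have "(v has_vector_derivative (- snd (v t), fst (v t) + (fst (v t))\<^sup>2)) (at t)"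
      using v by (simp add: oval_solution_def ham_solution_def ham_field_proj)
    from bounded_linear.has_vector_derivative[OF bounded_linear_fst this]
    have "deriv (\<lambda>s. fst (v s)) t = - snd (v t)"
      by (intro DERIV_imp_deriv) (simp add: has_real_derivative_iff_has_vector_derivative)
    then have eq: "fst (v t) ^ j * snd (v t) * deriv (\<lambda>s. fst (v s)) t
       = - (xcoord (sqrt (2 * h) * cos \<theta>) ^ j * (2 * h * (sin \<theta>)\<^sup>2))"
      using h by (simp add: c oval_point_def \<theta>_def power2_eq_square flip: real_sqrt_mult)
    have "(\<Theta> has_real_derivative inverse (weight (sqrt (2 * h) * cos \<theta>))) (at (t + c))"
      using clock by (simp add: oval_clock_def \<theta>_def)
    then have "((\<lambda>t. \<Theta> (t + c)) has_real_derivative inverse (weight (sqrt (2 * h) * cos \<theta>))) (at t)"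
      by (simp add: DERIV_shift)
    from DERIV_minus[OF DERIV_chain2[OF F(1) this]]
    have "((\<lambda>t. - F (\<Theta> (t + c))) has_real_derivative
       - (?k \<theta> * inverse (weight (sqrt (2 * h) * cos \<theta>)))) (at t)" by (simp add: \<theta>_def)
    moreover have "- (?k \<theta> * inverse (weight (sqrt (2 * h) * cos \<theta>)))
       = - (xcoord (sqrt (2 * h) * cos \<theta>) ^ j * (2 * h * (sin \<theta>)\<^sup>2))"
      using q by (simp add: field_simps)
    ultimately show ?thesis by (simp only: eq)
  qed
  have pos: "0 \<le> xmoment 0 h"
    unfolding xmoment_integral
    by (intro integral_nonneg integrable_continuous_interval continuous_intros
        continuous_on_level_cos continuous_on_xcoord continuous_on_weight h)
       (simp add: less_imp_le[OF weight_pos[OF level_cos_bound[OF h]]])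
  have "((\<lambda>t. fst (v t) ^ j * snd (v t) * deriv (\<lambda>s. fst (v s)) t) has_integral
      - F (\<Theta> (xmoment 0 h + c)) - (- F (\<Theta> (0 + c)))) {0..xmoment 0 h}"
    using integrand pos by (intro fundamental_theorem_of_calculus)
      (auto simp: has_real_derivative_iff_has_vector_derivative[symmetric] intro: has_field_derivative_at_within)
  moreover have "F (\<Theta> (xmoment 0 h + c)) = F (\<Theta> c) + xflux j h"
    using clock F(2) by (simp add: oval_clock_def xflux_integral add.commute[of _ c])
  ultimately show ?thesis
    by (simp add: ham_integral_def ham_period_eq v_def[symmetric] integral_unique)
qed

end

subsection \<open>Polynomial coefficients and linear combinations\<close>

lemma ham_integral_recurrence:
  assumes "0 < h" "h < 1/6"
  shows "(2 * real k + 11) * ham_integral (k + 3) h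
    = 3 * (2 * h * (real k + 1) * ham_integral k h - (real k + 4) * ham_integral (k + 2) h)"
  using xflux_recurrence[OF assms, of "k + 1"]
  by (simp add: ham_integral_eq[OF assms] algebra_simps numeral_eq_Suc)

lemma ham_integral_2:
  assumes "0 < h" "h < 1/6"
  shows "ham_integral 2 h = - ham_integral 1 h"
  using xflux_recurrence[OF assms, of 0] by (simp add: ham_integral_eq[OF assms] numeral_2_eq_2)

fun integral_poly :: "rat poly \<Rightarrow> rat poly \<Rightarrow> nat \<Rightarrow> rat poly" where
  "integral_poly p q 0 = p"
| "integral_poly p q (Suc 0) = q"
| "integral_poly p q (Suc (Suc 0)) = - q"
| "integral_poly p q (Suc (Suc (Suc k))) = smult (3 / (2 * of_nat k + 11))
     (smult (2 * (of_nat k + 1)) (pCons 0 (integral_poly p q k))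
      - smult (of_nat k + 4) (integral_poly p q (Suc (Suc k))))"

lemma rat_poly_eval_0 [simp]: "rat_poly_eval 0 h = 0"
  by (simp add: rat_poly_eval_def)

lemma rat_poly_eval_pCons [simp]: "rat_poly_eval (pCons a p) h = of_rat a + h * rat_poly_eval p h"
  by (simp add: rat_poly_eval_def map_poly_pCons)

lemma rat_poly_eval_smult [simp]: "rat_poly_eval (smult a p) h = of_rat a * rat_poly_eval p h"
  by (induction p) (simp_all add: of_rat_mult algebra_simps)

lemma rat_poly_eval_minus [simp]: "rat_poly_eval (- p) h = - rat_poly_eval p h"
  by (induction p) (simp_all add: of_rat_minus algebra_simps)

lemma rat_poly_eval_diff [simp]: "rat_poly_eval (p - q) h = rat_poly_eval p h - rat_poly_eval q h"
  by (induction p q rule: poly_induct2) (simp_all add: of_rat_diff right_diff_distrib)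

abbreviation area_coeff :: "nat \<Rightarrow> rat poly" where
  "area_coeff \<equiv> integral_poly [:-1:] [:6/7, -30/7:]"

abbreviation period_coeff :: "nat \<Rightarrow> rat poly" where
  "period_coeff \<equiv> integral_poly 0 [:6/7:]"

lemma ham_integral_eq_coeffs:
  assumes h: "0 < h" "h < 1/6"
  shows "ham_integral k h = rat_poly_eval (area_coeff k) h * ham_area h
    + rat_poly_eval (period_coeff k) h * (6 * h - 1) * h * ham_period h"
proof (induction k rule: less_induct)
  case (less k)
  have one: "ham_integral 1 h = rat_poly_eval (area_coeff 1) h * ham_area h
      + rat_poly_eval (period_coeff 1) h * (6 * h - 1) * h * ham_period h"
    using xflux_1[OF h]
    by (simp add: ham_integral_eq[OF h] ham_area_eq[OF h] ham_period_eq[OF h] of_rat_divide of_rat_minus field_simps)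
  consider "k = 0" | "k = 1" | "k = 2" | m where "k = m + 3"
    by atomize_elim presburger
  then show ?case
  proof cases
    case 1
    then show ?thesis by (simp add: ham_integral_eq[OF h] ham_area_eq[OF h] of_rat_minus)
  next
    case 2
    then show ?thesis using one by simp
  next
    case 3
    then show ?thesis using one ham_integral_2[OF h] by (simp add: numeral_2_eq_2 of_rat_minus algebra_simps)
  next
    case 4
    let ?A = "\<lambda>j. rat_poly_eval (area_coeff j) h" and ?Q = "\<lambda>j. rat_poly_eval (period_coeff j) h"
    define X where "X = (6 * h - 1) * h * ham_period h"
    have IH: "ham_integral m h = ?A m * ham_area h + ?Q m * X"
      "ham_integral (m + 2) h = ?A (m + 2) * ham_area h + ?Q (m + 2) * X"
      using less[of m] less[of "m + 2"] 4 by (simp_all add: X_def mult.assoc)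
    have A: "?A k = 3 / (2 * real m + 11) * (2 * (real m + 1) * (h * ?A m) - (real m + 4) * ?A (m + 2))"
      and Q: "?Q k = 3 / (2 * real m + 11) * (2 * (real m + 1) * (h * ?Q m) - (real m + 4) * ?Q (m + 2))"
      by (simp_all add: 4 numeral_3_eq_3 of_rat_divide of_rat_mult of_rat_add)
    have "ham_integral k h = 3 / (2 * real m + 11)
        * (2 * h * (real m + 1) * ham_integral m h - (real m + 4) * ham_integral (m + 2) h)"
      using ham_integral_recurrence[OF h, of m] by (simp add: 4 field_simps)
    also have "\<dots> = ?A k * ham_area h + ?Q k * X"
      unfolding IH A Q by (simp add: algebra_simps)
    finally show ?thesis by (simp add: X_def mult.assoc)
  qed
qed

definition leading_sign :: "rat poly \<Rightarrow> nat \<Rightarrow> rat \<Rightarrow> bool" where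
  "leading_sign p n s \<longleftrightarrow> degree p \<le> n \<and> s * coeff p n > 0"

lemma leading_sign_has_degree: "leading_sign p n s \<Longrightarrow> has_degree p n"
  unfolding leading_sign_def has_degree_def by (metis coeff_0 le_antisym le_degree less_irrefl mult_zero_right)

text \<open>In the recursion the two terms that can contribute to the leading coefficient have the same
  sign, so no cancellation takes place.\<close>

lemma leading_sign_integral_poly_step:
  assumes "leading_sign (integral_poly p q k) n s"
    and "degree (integral_poly p q (Suc (Suc k))) \<le> Suc n"
    and "s * coeff (integral_poly p q (Suc (Suc k))) (Suc n) \<le> 0"
  shows "leading_sign (integral_poly p q (Suc (Suc (Suc k)))) (Suc n) s"
proof -
  let ?u = "coeff (integral_poly p q k) n" and ?v = "coeff (integral_poly p q (Suc (Suc k))) (Suc n)"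
  have "degree (pCons 0 (integral_poly p q k)) \<le> Suc n"
    using assms(1) by (auto simp: leading_sign_def degree_pCons_eq_if)
  then have "degree (integral_poly p q (Suc (Suc (Suc k)))) \<le> Suc n"
    using assms(2) by (auto intro!: degree_diff_le order_trans[OF degree_smult_le])
  moreover have "s * coeff (integral_poly p q (Suc (Suc (Suc k)))) (Suc n)
      = 3 / (2 * of_nat k + 11) * (2 * (of_nat k + 1) * (s * ?u) - (of_nat k + 4) * (s * ?v))"
    by (simp add: algebra_simps)
  moreover have "(of_nat k + 4) * (s * ?v) \<le> 0"
    by (rule mult_nonneg_nonpos[OF _ assms(3)]) simp
  moreover have "2 * (of_nat k + 1) * (s * ?u) > 0"
    using assms(1) by (intro mult_pos_pos[of _ "s * ?u"]) (auto simp: leading_sign_def add_nonneg_pos)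
  moreover have "3 / (2 * of_nat k + 11 :: rat) > 0"
    by (intro divide_pos_pos add_nonneg_pos) auto
  ultimately show ?thesis
    unfolding leading_sign_def by (metis diff_gt_0_iff_gt mult_pos_pos order_le_less_trans)
qed

lemma leading_sign_integral_poly:
  assumes "leading_sign (integral_poly p q 1) d s" "leading_sign (integral_poly p q 2) d (- s)"
    "leading_sign (integral_poly p q 3) d s"
  shows "leading_sign (integral_poly p q (3 * n + 1)) (d + n) s \<and>
    leading_sign (integral_poly p q (3 * n + 2)) (d + n) (- s) \<and>
    leading_sign (integral_poly p q (3 * n + 3)) (d + n) s"
proof (induction n)
  case 0
  then show ?case using assms by (simp add: numeral_2_eq_2 del: integral_poly.simps)
next
  case (Suc n)
  let ?P = "integral_poly p q"
  have IH: "leading_sign (?P (Suc (3 * n))) (d + n) s"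
    "leading_sign (?P (Suc (Suc (3 * n)))) (d + n) (- s)"
    "leading_sign (?P (Suc (Suc (Suc (3 * n))))) (d + n) s"
    using Suc.IH by (simp_all add: numeral_2_eq_2 numeral_3_eq_3 del: integral_poly.simps)
  have 4: "leading_sign (?P (Suc (Suc (Suc (Suc (3 * n)))))) (Suc (d + n)) s"
    using IH(3) by (intro leading_sign_integral_poly_step IH(1))
      (auto simp: leading_sign_def coeff_eq_0 simp del: integral_poly.simps)
  have 5: "leading_sign (?P (Suc (Suc (Suc (Suc (Suc (3 * n))))))) (Suc (d + n)) (- s)"
    using 4 by (intro leading_sign_integral_poly_step IH(2))
      (auto simp: leading_sign_def simp del: integral_poly.simps)
  have 6: "leading_sign (?P (Suc (Suc (Suc (Suc (Suc (Suc (3 * n)))))))) (Suc (d + n)) s"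
    using 5 by (intro leading_sign_integral_poly_step IH(3))
      (auto simp: leading_sign_def simp del: integral_poly.simps)
  have idx: "3 * Suc n + 1 = Suc (Suc (Suc (Suc (3 * n))))"
    "3 * Suc n + 2 = Suc (Suc (Suc (Suc (Suc (3 * n)))))"
    "3 * Suc n + 3 = Suc (Suc (Suc (Suc (Suc (Suc (3 * n))))))" "d + Suc n = Suc (d + n)" by simp_all
  show ?case unfolding idx using 4 5 6 by blast
qed

lemma has_degree_area_coeff:
  "has_degree (area_coeff (3 * n + 1)) (n + 1) \<and> has_degree (area_coeff (3 * n + 2)) (n + 1) \<and>
   has_degree (area_coeff (3 * n + 3)) (n + 1)"
proof -
  have "leading_sign (area_coeff 1) 1 (- 1)" by (simp add: leading_sign_def)
  moreover have "leading_sign (area_coeff 2) 1 (- (- 1))"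
    by (simp add: leading_sign_def numeral_2_eq_2)
  moreover have "leading_sign (area_coeff 3) 1 (- 1)"
    by (simp add: leading_sign_def numeral_3_eq_3)
  ultimately show ?thesis
    unfolding add.commute[of n 1] using leading_sign_integral_poly leading_sign_has_degree by blast
qed

lemma has_degree_period_coeff:
  "has_degree (period_coeff (3 * n + 1)) n \<and> has_degree (period_coeff (3 * n + 2)) n \<and>
   has_degree (period_coeff (3 * n + 3)) n"
proof -
  have "leading_sign (period_coeff 1) 0 1" by (simp add: leading_sign_def)
  moreover have "leading_sign (period_coeff 2) 0 (- 1)"
    by (simp add: leading_sign_def numeral_2_eq_2)
  moreover have "leading_sign (period_coeff 3) 0 1"
    by (simp add: leading_sign_def numeral_3_eq_3)
  ultimately have "leading_sign (period_coeff (3 * n + 1)) (0 + n) 1 \<and>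
      leading_sign (period_coeff (3 * n + 2)) (0 + n) (- 1) \<and>
      leading_sign (period_coeff (3 * n + 3)) (0 + n) 1"
    by (rule leading_sign_integral_poly)
  then show ?thesis unfolding add_0 using leading_sign_has_degree by blast
qed

definition lower_combination :: "nat \<Rightarrow> (real \<Rightarrow> real) \<Rightarrow> bool" where
  "lower_combination m f \<longleftrightarrow> (\<exists>k :: nat \<Rightarrow> real. \<forall>h\<in>{0<..<1/6}.
     f h = (\<Sum>j | j < m \<and> j mod 3 \<noteq> 2. k j * ham_integral j h))"

lemma lower_combination_cong:
  assumes "lower_combination m f" "\<And>h. h \<in> {0<..<1/6} \<Longrightarrow> g h = f h"
  shows "lower_combination m g"
  using assms unfolding lower_combination_def by simp

lemma lower_combination_add:
  assumes "lower_combination m f" "lower_combination m g"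
  shows "lower_combination m (\<lambda>h. f h + g h)"
proof -
  obtain k l where "\<forall>h\<in>{0<..<1/6}. f h = (\<Sum>j | j < m \<and> j mod 3 \<noteq> 2. k j * ham_integral j h)"
    "\<forall>h\<in>{0<..<1/6}. g h = (\<Sum>j | j < m \<and> j mod 3 \<noteq> 2. l j * ham_integral j h)"
    using assms unfolding lower_combination_def by blast
  then show ?thesis unfolding lower_combination_def
    by (intro exI[of _ "\<lambda>j. k j + l j"]) (simp add: distrib_right sum.distrib)
qed

lemma lower_combination_scale:
  assumes "lower_combination m f"
  shows "lower_combination m (\<lambda>h. c * f h)"
proof -
  obtain k where "\<forall>h\<in>{0<..<1/6}. f h = (\<Sum>j | j < m \<and> j mod 3 \<noteq> 2. k j * ham_integral j h)"
    using assms unfolding lower_combination_def by blast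
  then show ?thesis unfolding lower_combination_def
    by (intro exI[of _ "\<lambda>j. c * k j"]) (simp add: sum_distrib_left mult.assoc)
qed

lemma lower_combination_sum:
  assumes "finite S" "\<And>j. j \<in> S \<Longrightarrow> lower_combination m (f j)"
  shows "lower_combination m (\<lambda>h. \<Sum>j\<in>S. f j h)"
  using assms
proof (induction S)
  case empty
  show ?case unfolding lower_combination_def by (intro exI[of _ "\<lambda>_. 0"]) simp
next
  case (insert i S)
  then show ?case using lower_combination_add[of m "f i"] by simp
qed

lemma lower_combination_ham_integral:
  assumes "j < m" "j mod 3 \<noteq> 2"
  shows "lower_combination m (ham_integral j)"
  unfolding lower_combination_def
proof (intro exI ballI)
  fix h :: real
  have "(\<Sum>i | i < m \<and> i mod 3 \<noteq> 2. (if i = j then 1 else 0) * ham_integral i h)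
      = (\<Sum>i | i < m \<and> i mod 3 \<noteq> 2. if i = j then ham_integral i h else 0)"
    by (intro sum.cong) auto
  also have "\<dots> = ham_integral j h" using assms by (subst sum.delta) auto
  finally show "ham_integral j h
      = (\<Sum>i | i < m \<and> i mod 3 \<noteq> 2. (if i = j then 1 else 0) * ham_integral i h)" by simp
qed

lemma lower_combination_mono:
  assumes "lower_combination m f" "m \<le> m'"
  shows "lower_combination m' f"
proof -
  obtain k where k: "\<forall>h\<in>{0<..<1/6}. f h = (\<Sum>j | j < m \<and> j mod 3 \<noteq> 2. k j * ham_integral j h)"
    using assms unfolding lower_combination_def by blast
  have "lower_combination m' (\<lambda>h. \<Sum>j | j < m \<and> j mod 3 \<noteq> 2. k j * ham_integral j h)"
    using assms(2)
    by (intro lower_combination_sum lower_combination_scale lower_combination_ham_integral) auto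
  then show ?thesis by (rule lower_combination_cong) (use k in auto)
qed

text \<open>Reading the recurrence backwards expresses \<open>h I\<^sub>j\<close> through \<open>I\<^bsub>j+3\<^esub>\<close> and \<open>I\<^bsub>j+2\<^esub>\<close>,
  which removes the factor \<open>h\<close> from the recurrence for \<open>I\<^bsub>3n+2\<^esub>\<close>.\<close>

lemma ham_integral_lower_combination: "lower_combination (3 * n + 2) (ham_integral (3 * n + 2))"
proof (induction n rule: less_induct)
  case (less n)
  show ?case
  proof (cases n)
    case 0
    have "lower_combination 2 (\<lambda>h. -1 * ham_integral 1 h)"
      by (intro lower_combination_scale lower_combination_ham_integral) auto
    then have "lower_combination 2 (ham_integral 2)"
      by (rule lower_combination_cong) (simp add: ham_integral_2)
    then show ?thesis by (simp add: 0 numeral_2_eq_2)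
  next
    case (Suc m)
    have times_h: "lower_combination (3 * n + 2) (\<lambda>h. h * ham_integral j h)"
      if j: "j < 3 * m + 2" "j mod 3 \<noteq> 2" for j
    proof -
      have "lower_combination (3 * n + 2) (ham_integral (j + 2))"
      proof (cases "j mod 3 = 0")
        case True
        then obtain i where i: "j = 3 * i" by auto
        then have "lower_combination (j + 2) (ham_integral (j + 2))"
          using less[of i] j Suc by auto
        then show ?thesis by (rule lower_combination_mono) (use j Suc in auto)
      next
        case False
        then have "(j + 2) mod 3 \<noteq> 2" using j by presburger
        then show ?thesis using j Suc by (intro lower_combination_ham_integral) auto
      qed
      moreover have "lower_combination (3 * n + 2) (ham_integral (j + 3))"
        using j Suc by (intro lower_combination_ham_integral) auto
      ultimately have "lower_combination (3 * n + 2) (\<lambda>h.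
          (2 * real j + 11) / (6 * (real j + 1)) * ham_integral (j + 3) h
          + (real j + 4) / (2 * (real j + 1)) * ham_integral (j + 2) h)"
        by (intro lower_combination_add lower_combination_scale)
      then show ?thesis
      proof (rule lower_combination_cong)
        fix h :: real assume "h \<in> {0<..<1/6}"
        then have rec: "(2 * real j + 11) * ham_integral (j + 3) h
            = 3 * (2 * h * (real j + 1) * ham_integral j h - (real j + 4) * ham_integral (j + 2) h)"
          by (intro ham_integral_recurrence) auto
        have "(2 * real j + 11) / (6 * (real j + 1)) * ham_integral (j + 3) h
            = (2 * real j + 11) * ham_integral (j + 3) h / (6 * (real j + 1))" by simp
        also have "\<dots> = h * ham_integral j h - (real j + 4) / (2 * (real j + 1)) * ham_integral (j + 2) h"
          unfolding rec by (simp add: field_simps add_nonneg_pos)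
        finally show "h * ham_integral j h
            = (2 * real j + 11) / (6 * (real j + 1)) * ham_integral (j + 3) h
            + (real j + 4) / (2 * (real j + 1)) * ham_integral (j + 2) h" by simp
      qed
    qed
    obtain k where k: "\<forall>h\<in>{0<..<1/6}. ham_integral (3 * m + 2) h
        = (\<Sum>j | j < 3 * m + 2 \<and> j mod 3 \<noteq> 2. k j * ham_integral j h)"
      using less[of m] Suc unfolding lower_combination_def by auto
    have "lower_combination (3 * n + 2)
        (\<lambda>h. \<Sum>j | j < 3 * m + 2 \<and> j mod 3 \<noteq> 2. k j * (h * ham_integral j h))"
      by (intro lower_combination_sum lower_combination_scale times_h) auto
    then have "lower_combination (3 * n + 2) (\<lambda>h. h * ham_integral (3 * m + 2) h)"
      by (rule lower_combination_cong) (use k in \<open>auto simp: sum_distrib_left algebra_simps\<close>)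
    moreover have "lower_combination (3 * n + 2) (ham_integral (3 * m + 4))"
    proof (rule lower_combination_ham_integral)
      show "(3 * m + 4) mod 3 \<noteq> 2" by presburger
    qed (use Suc in auto)
    ultimately have "lower_combination (3 * n + 2) (\<lambda>h.
        6 * (real (3 * m + 2) + 1) / (2 * real (3 * m + 2) + 11) * (h * ham_integral (3 * m + 2) h)
        + - 3 * (real (3 * m + 2) + 4) / (2 * real (3 * m + 2) + 11) * ham_integral (3 * m + 4) h)"
      by (intro lower_combination_add lower_combination_scale)
    then show ?thesis
    proof (rule lower_combination_cong)
      fix h :: real assume h: "h \<in> {0<..<1/6}"
      define r where "r = real (3 * m + 2)"
      have "(2 * r + 11) * ham_integral (3 * n + 2) h
          = 3 * (2 * h * (r + 1) * ham_integral (3 * m + 2) h - (r + 4) * ham_integral (3 * m + 4) h)"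
        using ham_integral_recurrence[of h "3 * m + 2"] h by (simp add: Suc r_def numeral_eq_Suc)
      moreover have "2 * r + 11 > 0" by (simp add: r_def)
      ultimately have "ham_integral (3 * n + 2) h
          = 3 * (2 * h * (r + 1) * ham_integral (3 * m + 2) h - (r + 4) * ham_integral (3 * m + 4) h) / (2 * r + 11)"
        by (simp add: nonzero_eq_divide_eq mult.commute)
      also have "\<dots> = 6 * (r + 1) / (2 * r + 11) * (h * ham_integral (3 * m + 2) h)
          + - 3 * (r + 4) / (2 * r + 11) * ham_integral (3 * m + 4) h"
        by (simp add: divide_inverse algebra_simps)
      finally show "ham_integral (3 * n + 2) h
          = 6 * (real (3 * m + 2) + 1) / (2 * real (3 * m + 2) + 11) * (h * ham_integral (3 * m + 2) h)
          + - 3 * (real (3 * m + 2) + 4) / (2 * real (3 * m + 2) + 11) * ham_integral (3 * m + 4) h"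
        by (simp only: r_def)
    qed
  qed
qed

lemma ham_area_has_derivative:
  assumes h: "0 < h" "h < 1/6"
  shows "(ham_area has_real_derivative ham_period h) (at h)"
  using xflux_has_derivative[OF h, of 0] h
  by (auto intro!: has_field_derivative_transform_within_open[of "xflux 0" _ h "{0<..<1/6}"]
      simp: ham_area_eq ham_period_eq)

lemma ham_period_has_derivative:
  assumes h: "0 < h" "h < 1/6"
  shows "(ham_period has_real_derivative 5 / (6 * (1 - 6 * h) * h) * ham_area h) (at h)"
proof -
  have "- 5 * xflux 0 h / (6 * h * (6 * h - 1)) = 5 / (6 * (1 - 6 * h) * h) * ham_area h"
    using h by (simp add: ham_area_eq field_simps)
  then show ?thesis
    using xmoment_0_has_derivative[OF h] h
    by (auto intro!: has_field_derivative_transform_within_open[of "xmoment 0" _ h "{0<..<1/6}"]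
      simp: ham_period_eq)
qed

lemma ham_area_period_derivs:
  assumes "h \<in> {0<..<1/6}"
  shows "deriv ham_area h = ham_period h" "deriv ham_period h = 5 / (6 * (1 - 6 * h) * h) * ham_area h"
    "(deriv ham_area has_real_derivative 5 / (6 * (1 - 6 * h) * h) * ham_area h) (at h)"
proof -
  show A: "deriv ham_area h = ham_period h"
    using assms ham_area_has_derivative[of h] by (intro DERIV_imp_deriv) auto
  show "deriv ham_period h = 5 / (6 * (1 - 6 * h) * h) * ham_area h"
    using assms ham_period_has_derivative[of h] by (intro DERIV_imp_deriv) auto
  show "(deriv ham_area has_real_derivative 5 / (6 * (1 - 6 * h) * h) * ham_area h) (at h)"
    by (rule has_field_derivative_transform_within_open[of ham_period _ h "{0<..<1/6}"])
      (use assms ham_period_has_derivative in \<open>auto intro!: DERIV_imp_deriv[symmetric] ham_area_has_derivative\<close>)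
qed

lemma period_area_quotient_has_derivative:
  assumes h: "0 < h" "h < 1/6"
  shows "((\<lambda>h. ham_period h / ham_area h) has_real_derivative
    - ((ham_period h / ham_area h)\<^sup>2) + 5 / (6 * (1 - 6 * h) * h)) (at h)"
proof -
  have nz: "ham_area h \<noteq> 0" using ham_area_pos[OF h] by simp
  have "((\<lambda>h. ham_period h / ham_area h) has_real_derivative
     (5 / (6 * (1 - 6 * h) * h) * ham_area h * ham_area h - ham_period h * ham_period h) / (ham_area h * ham_area h)) (at h)"
    by (rule DERIV_divide[OF ham_period_has_derivative[OF h] ham_area_has_derivative[OF h] nz])
  moreover have "(c * ham_area h * ham_area h - ham_period h * ham_period h) / (ham_area h * ham_area h)
      = - ((ham_period h / ham_area h)\<^sup>2) + c" for c
    using nz by (simp add: power2_eq_square diff_divide_distrib)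
  ultimately show ?thesis by (simp only:)
qed

theorem proposition1p2:
  shows
   "(\<forall>h\<in>{0<..<1/6}.
        ham_area differentiable at h \<and> ham_period differentiable at h \<and>
        (6 * (6 * h - 1) * h) *\<^sub>R (vector [deriv ham_area h, deriv ham_period h] :: real^2) =
        (vector [vector [0, 6 * (6 * h - 1) * h], vector [-5, 0]] :: real^2^2)
          *v vector [ham_area h, ham_period h]) \<and>
    (\<forall>h\<in>{0<..<1/6}.
        deriv ham_area differentiable at h \<and>
        deriv (deriv ham_area) h = 5 / (6 * (1 - 6 * h) * h) * ham_area h) \<and>
    (let p = (\<lambda>h. ham_period h / ham_area h) in
      (\<forall>h\<in>{0<..<1/6}.
        ham_area h \<noteq> 0 \<and> p differentiable at h \<and>
        deriv p h = - ((p h)^2) + 5 / (6 * (1 - 6 * h) * h))) \<and>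
    (\<forall>h\<in>{0<..<1/6}. ham_integral 0 h = - ham_area h) \<and>
    (\<exists>a b c d e f :: nat \<Rightarrow> rat poly. \<forall>n.
        has_degree (a (n + 1)) (n + 1) \<and> has_degree (b n) n \<and>
        has_degree (c (n + 1)) (n + 1) \<and> has_degree (d n) n \<and>
        has_degree (e (n + 1)) (n + 1) \<and> has_degree (f n) n \<and>
        (\<forall>h\<in>{0<..<1/6}.
          ham_integral (3 * n + 1) h =
            rat_poly_eval (a (n + 1)) h * ham_area h
            + rat_poly_eval (b n) h * (6 * h - 1) * h * ham_period h \<and>
          ham_integral (3 * n + 2) h =
            rat_poly_eval (c (n + 1)) h * ham_area h
            + rat_poly_eval (d n) h * (6 * h - 1) * h * ham_period h \<and>
          ham_integral (3 * n + 3) h =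
            rat_poly_eval (e (n + 1)) h * ham_area h
            + rat_poly_eval (f n) h * (6 * h - 1) * h * ham_period h)) \<and>
    (\<forall>n. \<exists>k :: nat \<Rightarrow> real. \<forall>h\<in>{0<..<1/6}.
        ham_integral (3 * n + 2) h =
          (\<Sum>j | j < 3 * n + 2 \<and> j mod 3 \<noteq> 2. k j * ham_integral j h))"
proof (intro conjI)
  show "\<forall>h\<in>{0<..<1/6}.
        ham_area differentiable at h \<and> ham_period differentiable at h \<and>
        (6 * (6 * h - 1) * h) *\<^sub>R (vector [deriv ham_area h, deriv ham_period h] :: real^2) =
        (vector [vector [0, 6 * (6 * h - 1) * h], vector [-5, 0]] :: real^2^2)
          *v vector [ham_area h, ham_period h]"
  proof
    fix h :: real assume h: "h \<in> {0<..<1/6}"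
    define c where "c = 6 * (1 - 6 * h) * h"
    have "6 * (6 * h - 1) * h = - c" "c \<noteq> 0" using h by (auto simp: c_def algebra_simps)
    then have "6 * (6 * h - 1) * h * (5 / c * ham_area h) = - 5 * ham_area h" by simp
    then have "6 * (6 * h - 1) * h * (5 / (6 * (1 - 6 * h) * h) * ham_area h) = - 5 * ham_area h"
      unfolding c_def .
    moreover have "ham_area differentiable at h" "ham_period differentiable at h"
      using h ham_area_has_derivative[of h] ham_period_has_derivative[of h] by (auto simp: real_differentiable_def)
    ultimately show "ham_area differentiable at h \<and> ham_period differentiable at h \<and>
        (6 * (6 * h - 1) * h) *\<^sub>R (vector [deriv ham_area h, deriv ham_period h] :: real^2) =
        (vector [vector [0, 6 * (6 * h - 1) * h], vector [-5, 0]] :: real^2^2)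
          *v vector [ham_area h, ham_period h]"
      unfolding ham_area_period_derivs[OF h]
      by (simp add: vec_eq_iff forall_2 matrix_vector_mult_def sum_2)
  qed
  show "\<forall>h\<in>{0<..<1/6}.
        deriv ham_area differentiable at h \<and>
        deriv (deriv ham_area) h = 5 / (6 * (1 - 6 * h) * h) * ham_area h"
  proof
    fix h :: real assume "h \<in> {0<..<1/6}"
    note D = ham_area_period_derivs(3)[OF this]
    then have "deriv ham_area differentiable at h" unfolding real_differentiable_def by blast
    then show "deriv ham_area differentiable at h \<and>
        deriv (deriv ham_area) h = 5 / (6 * (1 - 6 * h) * h) * ham_area h"
      using DERIV_imp_deriv[OF D] by (rule conjI)
  qed
  show "let p = (\<lambda>h. ham_period h / ham_area h) in
      (\<forall>h\<in>{0<..<1/6}.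
        ham_area h \<noteq> 0 \<and> p differentiable at h \<and>
        deriv p h = - ((p h)^2) + 5 / (6 * (1 - 6 * h) * h))"
    unfolding Let_def
  proof
    fix h :: real assume h: "h \<in> {0<..<1/6}"
    then have "ham_area h \<noteq> 0" using ham_area_pos[of h] by simp
    then show "ham_area h \<noteq> 0 \<and> (\<lambda>h. ham_period h / ham_area h) differentiable at h \<and>
        deriv (\<lambda>h. ham_period h / ham_area h) h
          = - ((ham_period h / ham_area h)^2) + 5 / (6 * (1 - 6 * h) * h)"
      using period_area_quotient_has_derivative[of h] h DERIV_imp_deriv real_differentiable_def by auto
  qed
  show "\<forall>h\<in>{0<..<1/6}. ham_integral 0 h = - ham_area h"
    by (simp add: ham_integral_eq ham_area_eq)
  show "\<forall>n. \<exists>k :: nat \<Rightarrow> real. \<forall>h\<in>{0<..<1/6}.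
        ham_integral (3 * n + 2) h =
          (\<Sum>j | j < 3 * n + 2 \<and> j mod 3 \<noteq> 2. k j * ham_integral j h)"
    using ham_integral_lower_combination unfolding lower_combination_def by blast
  have coeffs: "ham_integral k h = rat_poly_eval (area_coeff k) h * ham_area h
      + rat_poly_eval (period_coeff k) h * (6 * h - 1) * h * ham_period h"
    if "h \<in> {0<..<1/6}" for k h
    using that by (intro ham_integral_eq_coeffs) auto
  show "\<exists>a b c d e f :: nat \<Rightarrow> rat poly. \<forall>n.
        has_degree (a (n + 1)) (n + 1) \<and> has_degree (b n) n \<and>
        has_degree (c (n + 1)) (n + 1) \<and> has_degree (d n) n \<and>
        has_degree (e (n + 1)) (n + 1) \<and> has_degree (f n) n \<and>
        (\<forall>h\<in>{0<..<1/6}.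
          ham_integral (3 * n + 1) h =
            rat_poly_eval (a (n + 1)) h * ham_area h
            + rat_poly_eval (b n) h * (6 * h - 1) * h * ham_period h \<and>
          ham_integral (3 * n + 2) h =
            rat_poly_eval (c (n + 1)) h * ham_area h
            + rat_poly_eval (d n) h * (6 * h - 1) * h * ham_period h \<and>
          ham_integral (3 * n + 3) h =
            rat_poly_eval (e (n + 1)) h * ham_area h
            + rat_poly_eval (f n) h * (6 * h - 1) * h * ham_period h)"
  proof (rule exI[of _ "\<lambda>k. area_coeff (3 * (k - 1) + 1)"], rule exI[of _ "\<lambda>n. period_coeff (3 * n + 1)"],
      rule exI[of _ "\<lambda>k. area_coeff (3 * (k - 1) + 2)"], rule exI[of _ "\<lambda>n. period_coeff (3 * n + 2)"],
      rule exI[of _ "\<lambda>k. area_coeff (3 * (k - 1) + 3)"], rule exI[of _ "\<lambda>n. period_coeff (3 * n + 3)"],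
      rule allI, unfold add_diff_cancel_right', goal_cases)
    case (1 n)
    show ?case
      using has_degree_area_coeff[of n] has_degree_period_coeff[of n]
        coeffs[of _ "3 * n + 1"] coeffs[of _ "3 * n + 2"] coeffs[of _ "3 * n + 3"]
      by (intro conjI ballI) (elim conjE, assumption | assumption)+
  qed
qed

end
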